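(* Let $1<p<\infty$ and $n\ge1$. There exists a constant $c=c(n,p)$, depending only on $n$ and $p$, such that for every cube $Q_0\subset\mathbb{R}^n$ and every $f\in JN^d_p(Q_0)$, \[ \|M^d_{Q_0}f\|_{JN^d_p(Q_0)}\le c\,\|f\|_{JN^d_p(Q_0)}. \]
   Context: $|A|$ denotes Lebesgue measure and $f_A=\frac1{|A|}\int_A f\,dx$ the integral average. A cube in $\mathbb{R}^n$ is a closed bounded cube $[a_1,b_1]\times\dots\times[a_n,b_n]$ with sides parallel to the coordinate axes and $b_1-a_1=\dots=b_n-a_n>0$. Dyadic subcubes: for a cube $Q_0$, $\mathcal{D}(Q_0)=\bigcup_{j=0}^\infty \mathcal{D}_j(Q_0)$, where $\mathcal{D}_j(Q_0)$ consists of the $2^{jn}$ closed cubes of side length $2^{-j}l(Q_0)$ ($l(Q_0)$ being the side length of $Q_0$), with pairwise disjoint interiors, obtained by dividing each side of $Q_0$ into $2^j$ equal parts. Elements of $\mathcal{D}(Q_0)$ are the dyadic subcubes of $Q_0$. Collections of dyadic cubes are called pairwise disjoint if their interiors are pairwise disjoint. Dyadic John--Nirenberg space: for $1<p<\infty$, a function $f\in L^1(Q_0)$ belongs to $JN^d_p(Q_0)$ if \[ \|f\|_{JN^d_{p}(Q_0)}^p=\sup\sum_{i}|Q_i|\Bigl(\frac1{|Q_i|}\int_{Q_i}|f-f_{Q_i}|\,dx\Bigr)^p<\infty, \] where the supremum is taken over countable collections $\{Q_i\}$ of pairwise disjoint dyadic subcubes of $Q_0$. Dyadic maximal function: for $f\in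 L^1(Q_0)$ and $x\in Q_0$, \[ M^d_{Q_0}f(x)=\sup\frac1{|Q|}\int_Q|f(y)|\,dy, \] where the supremum is taken over all $Q\in\mathcal{D}(Q_0)$ with $x\in Q$. *)

theory Defs
  imports "HOL-Analysis.Analysis"
begin

definition cube :: "real ^ 'n \<Rightarrow> real \<Rightarrow> (real ^ 'n) set" where
  "cube a l = cbox a (\<chi> i. a $ i + l)"

definition is_cube :: "(real ^ 'n) set \<Rightarrow> bool" where
  "is_cube Q \<longleftrightarrow> (\<exists>a l. l > 0 \<and> Q = cube a l)"

text \<open>The corner \<open>a\<close> and the side length \<open>l\<close> below are uniquely determined by the cube \<open>Q0\<close>.\<close>

definition dyadic_level :: "(real ^ 'n) set \<Rightarrow> nat \<Rightarrow> (real ^ 'n) set set" where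
  "dyadic_level Q0 j =
     {Q. \<exists>a l (k :: 'n \<Rightarrow> nat). l > 0 \<and> Q0 = cube a l \<and> (\<forall>i. k i < 2 ^ j) \<and>
           Q = cube (\<chi> i. a $ i + real (k i) * (l / 2 ^ j)) (l / 2 ^ j)}"

definition dyadic_subcubes :: "(real ^ 'n) set \<Rightarrow> (real ^ 'n) set set" where
  "dyadic_subcubes Q0 = (\<Union>j. dyadic_level Q0 j)"

definition avg :: "(real ^ 'n) set \<Rightarrow> (real ^ 'n \<Rightarrow> real) \<Rightarrow> real" where
  "avg A f = (1 / measure lebesgue A) * (\<integral>x. f x \<partial>lebesgue_on A)"

text \<open>Members of such a collection have nonempty, pairwise disjoint interiors, so no cube is
  repeated and collections can be taken to be sets of cubes.\<close>

definition dyadic_collections :: "(real ^ 'n) set \<Rightarrow> (real ^ 'n) set set set" where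
  "dyadic_collections Q0 =
     {C. C \<subseteq> dyadic_subcubes Q0 \<and> countable C \<and>
         pairwise (\<lambda>Q R. interior Q \<inter> interior R = {}) C}"

text \<open>The \<open>p\<close>-th power of the norm; it is meaningful only for \<open>f\<close> integrable on \<open>Q0\<close>.\<close>

definition JNd_sup :: "real \<Rightarrow> (real ^ 'n) set \<Rightarrow> (real ^ 'n \<Rightarrow> real) \<Rightarrow> ennreal" where
  "JNd_sup p Q0 f =
     (SUP C \<in> dyadic_collections Q0.
        \<Sum>\<^sub>\<infinity>Q\<in>C. ennreal (measure lebesgue Q * avg Q (\<lambda>x. \<bar>f x - avg Q f\<bar>) powr p))"

definition JNd :: "real \<Rightarrow> (real ^ 'n) set \<Rightarrow> (real ^ 'n \<Rightarrow> real) set" where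
  "JNd p Q0 = {f. integrable (lebesgue_on Q0) f \<and> JNd_sup p Q0 f < \<infinity>}"

text \<open>Since \<^term>\<open>enn2real\<close> sends \<open>\<infinity>\<close> to \<open>0\<close>, this is the norm only for members of \<^const>\<open>JNd\<close>.\<close>

definition JNd_norm :: "real \<Rightarrow> (real ^ 'n) set \<Rightarrow> (real ^ 'n \<Rightarrow> real) \<Rightarrow> real" where
  "JNd_norm p Q0 f = enn2real (JNd_sup p Q0 f) powr (1 / p)"

text \<open>The supremum may be infinite at some points, hence the extended value type.\<close>

definition dyadic_maximal :: "(real ^ 'n) set \<Rightarrow> (real ^ 'n \<Rightarrow> real) \<Rightarrow> real ^ 'n \<Rightarrow> ennreal" where
  "dyadic_maximal Q0 f x =
     (SUP Q \<in> {Q \<in> dyadic_subcubes Q0. x \<in> Q}. ennreal (avg Q (\<lambda>y. \<bar>f y\<bar>)))"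

end

theory Submission
  imports Defs
begin

text \<open>
  Fix a dyadic cube \<open>Q\<close>. On \<open>Q\<close> the maximal function lies between the constant \<open>a\<close> (the supremum of the
  averages of \<open>\<bar>f\<bar>\<close> over the dyadic cubes containing \<open>Q\<close>) and \<open>a + T\<close>, where \<open>T\<close> is the maximal
  function, over the dyadic subcubes of \<open>Q\<close>, of \<open>f - f_Q\<close>. Hence its mean oscillation on \<open>Q\<close> is at
  most twice the average of \<open>T\<close>.

  The integral of \<open>T\<close> over \<open>Q\<close> is at most \<open>C |Q|^(1-1/p) J(Q)^(1/p)\<close>, where \<open>J(Q)\<close> is the \<open>p\<close>-th power
  of the John--Nirenberg norm on \<open>Q\<close>. For finitely many cubes this follows by induction on their
  number: stop at the maximal cubes \<open>S\<close> on which the average of \<open>\<bar>f - f_Q\<bar>\<close> exceeds a large multiple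
  of the oscillation on \<open>Q\<close>. Outside them \<open>T\<close> is controlled by that multiple; on them the induction
  hypothesis applies, and since the \<open>S\<close> occupy a small part of \<open>Q\<close>, Hoelder's inequality and the
  superadditivity of \<open>J\<close> bound their total contribution by half of the claimed bound. Raising the
  estimate to the power \<open>p\<close> and using the superadditivity of \<open>J\<close> once more gives the theorem.

  Only the nesting of the dyadic cubes matters, so the argument is carried out for a countable nested
  family of sets in a finite measure space.
\<close>

section \<open>Hoelder's inequality for finite sums\<close>

text \<open>After dividing by the totals, Young's inequality bounds each term by a weighted
  arithmetic mean, and these means add up to \<open>s + t = 1\<close>. The form with exponents on
  the totals suits products such as measure to the \<open>1 - 1/p\<close> times \<open>JN\<close> to
  the \<open>1/p\<close>.\<close>

lemma Holder_inequality_sum_powr: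
  fixes a b :: "'i \<Rightarrow> real" and s t :: real
  assumes "0 < s" "0 < t" "s + t = 1"
    and nonneg: "\<And>i. i \<in> I \<Longrightarrow> 0 \<le> a i" "\<And>i. i \<in> I \<Longrightarrow> 0 \<le> b i"
  shows "(\<Sum>i\<in>I. a i powr s * b i powr t) \<le> (\<Sum>i\<in>I. a i) powr s * (\<Sum>i\<in>I. b i) powr t"
proof (cases "finite I")
  case fin: True
  define A where "A = (\<Sum>i\<in>I. a i)"
  define B where "B = (\<Sum>i\<in>I. b i)"
  have AB: "0 \<le> A" "0 \<le> B" unfolding A_def B_def using nonneg by (auto intro: sum_nonneg)
  show ?thesis
  \<comment> \<open>Normalising requires nonzero totals. If one total vanishes, so do all its
    nonnegative summands, and then every product is 0.\<close>
  proof (cases "A = 0 \<or> B = 0")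
    case True
    then have "(\<forall>i\<in>I. a i = 0) \<or> (\<forall>i\<in>I. b i = 0)"
      unfolding A_def B_def using fin nonneg by (simp add: sum_nonneg_eq_0_iff)
    then have "(\<Sum>i\<in>I. a i powr s * b i powr t) = 0" by (auto intro!: sum.neutral)
    then show ?thesis by simp
  next
    case False
    with AB have pos: "0 < A" "0 < B" by auto
    have "a i powr s * b i powr t \<le> A powr s * B powr t * (s * (a i / A) + t * (b i / B))"
      if i: "i \<in> I" for i
    proof (cases "a i = 0 \<or> b i = 0")
      case True
      then have "a i powr s * b i powr t = 0" by auto
      moreover have "0 \<le> s * (a i / A) + t * (b i / B)"
        using assms pos i by (intro add_nonneg_nonneg mult_nonneg_nonneg) auto
      then have "0 \<le> A powr s * B powr t * (s * (a i / A) + t * (b i / B))" by simp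
      ultimately show ?thesis by linarith
    next
      case False
      with i nonneg have ab: "0 < a i" "0 < b i" by force+
      have "(a i / A) powr s * (b i / B) powr t \<le> s * (a i / A) + t * (b i / B)"
        by (rule Youngs_inequality_0) (use assms pos ab in auto)
      then have "A powr s * B powr t * ((a i / A) powr s * (b i / B) powr t)
          \<le> A powr s * B powr t * (s * (a i / A) + t * (b i / B))"
        by (intro mult_left_mono) auto
      moreover have "A powr s * B powr t * ((a i / A) powr s * (b i / B) powr t) = a i powr s * b i powr t"
        using pos ab by (simp add: powr_divide)
      ultimately show ?thesis by linarith
    qed
    then have "(\<Sum>i\<in>I. a i powr s * b i powr t)
        \<le> (\<Sum>i\<in>I. A powr s * B powr t * (s * (a i / A) + t * (b i / B)))"
      by (rule sum_mono)
    also have "\<dots> = A powr s * B powr t * (s * (A / A) + t * (B / B))"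
      unfolding A_def B_def sum_divide_distrib
      by (simp only: sum_distrib_left[symmetric] sum.distrib)
    also have "\<dots> = A powr s * B powr t" using pos assms by simp
    finally show ?thesis unfolding A_def B_def .
  qed
qed simp

section \<open>Nested families of sets\<close>

text \<open>The counterpart of \<open>avg\<close> for an arbitrary measure: one ambient measure
  serves all sets, with no restriction to each of them.\<close>

definition mean :: "'a measure \<Rightarrow> 'a set \<Rightarrow> ('a \<Rightarrow> real) \<Rightarrow> real" where
  "mean M A f = (LINT x:A|M. f x) / measure M A"

definition oscillation :: "'a measure \<Rightarrow> 'a set \<Rightarrow> ('a \<Rightarrow> real) \<Rightarrow> real" where
  "oscillation M A f = mean M A (\<lambda>x. \<bar>f x - mean M A f\<bar>)"

lemma mean_nonneg: "(\<And>x. x \<in> A \<Longrightarrow> 0 \<le> f x) \<Longrightarrow> 0 \<le> mean M A f"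
  unfolding mean_def set_lebesgue_integral_def
  by (auto intro!: divide_nonneg_nonneg integral_nonneg simp: indicator_def)

lemma oscillation_nonneg: "0 \<le> oscillation M A f"
  unfolding oscillation_def by (rule mean_nonneg) simp

lemma oscillation_cong:
  assumes "\<And>x. x \<in> A \<Longrightarrow> f x = g x"
  shows "oscillation M A f = oscillation M A g"
proof -
  have *: "mean M A u = mean M A v" if "\<And>x. x \<in> A \<Longrightarrow> u x = v x" for u v
    unfolding mean_def set_lebesgue_integral_def
    using that by (intro arg_cong2[of _ _ _ _ "(/)"] Bochner_Integration.integral_cong) (auto simp: indicator_def)
  have "mean M A f = mean M A g" by (rule *) (rule assms)
  then show ?thesis unfolding oscillation_def by (intro *) (simp add: assms)
qed

text \<open>Additivity over the disjoint union, then monotonicity for a nonnegative integrand. It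
  controls the total deviation over the stopping sets.\<close>

lemma sum_set_integral_disjoint_le:
  fixes g :: "_ \<Rightarrow> real"
  assumes G: "finite G" "disjoint G" "G \<subseteq> sets M" "\<Union>G \<subseteq> Q" "Q \<in> sets M"
    and g: "set_integrable M Q g" "\<And>x. 0 \<le> g x"
  shows "(\<Sum>S\<in>G. LINT x:S|M. g x) \<le> (LINT x:Q|M. g x)"
proof -
  have "(LINT x:(\<Union>S\<in>G. S)|M. g x) = (\<Sum>S\<in>G. LINT x:S|M. g x)"
  proof (rule set_integral_finite_Union)
    show "disjoint_family_on (\<lambda>S. S) G"
      using G(2) by (auto simp: disjoint_family_on_def pairwise_def disjnt_def)
    show "set_integrable M S g" if "S \<in> G" for S
      using set_integrable_subset[OF g(1)] that G by blast
  qed (use G in auto)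
  moreover have "(LINT x:(\<Union>S\<in>G. S)|M. g x) \<le> (LINT x:Q|M. g x)"
    unfolding set_lebesgue_integral_def
  proof (rule integral_mono)
    have "(\<Union>S\<in>G. S) \<in> sets M" using G by (intro sets.finite_UN) auto
    then show "integrable M (\<lambda>x. indicator (\<Union>S\<in>G. S) x *\<^sub>R g x)"
      using set_integrable_subset[OF g(1)] G unfolding set_integrable_def by auto
    show "integrable M (\<lambda>x. indicator Q x *\<^sub>R g x)" using g(1) unfolding set_integrable_def .
    show "indicator (\<Union>S\<in>G. S) x *\<^sub>R g x \<le> indicator Q x *\<^sub>R g x" for x
      using g(2)[of x] G(4) by (auto simp: indicator_def)
  qed
  ultimately show ?thesis by simp
qed

lemma measure_times_mean:
  "measure M A \<noteq> 0 \<Longrightarrow> measure M A * mean M A f = (LINT x:A|M. f x)"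
  by (simp add: mean_def)

context finite_measure
begin

lemma set_integrable_const: "A \<in> sets M \<Longrightarrow> set_integrable M A (\<lambda>x. c::real)"
  unfolding set_integrable_def
  by (intro integrable_mult_indicator) auto

lemma mean_mono:
  assumes "set_integrable M A f" "set_integrable M A g" "\<And>x. x \<in> A \<Longrightarrow> f x \<le> g x"
  shows "mean M A f \<le> mean M A g"
  unfolding mean_def by (intro divide_right_mono set_integral_mono assms measure_nonneg)

lemma mean_const: "A \<in> sets M \<Longrightarrow> measure M A \<noteq> 0 \<Longrightarrow> mean M A (\<lambda>x. c) = c"
  unfolding mean_def set_lebesgue_integral_def by simp

lemma mean_add:
  assumes "set_integrable M A f" "set_integrable M A g"
  shows "mean M A (\<lambda>x. f x + g x) = mean M A f + mean M A g"
  unfolding mean_def using assms by (simp add: add_divide_distrib)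

lemma mean_diff:
  assumes "set_integrable M A f" "set_integrable M A g"
  shows "mean M A (\<lambda>x. f x - g x) = mean M A f - mean M A g"
  unfolding mean_def using assms by (simp add: diff_divide_distrib)

lemma abs_mean_le:
  assumes "set_integrable M A f"
  shows "\<bar>mean M A f\<bar> \<le> mean M A (\<lambda>x. \<bar>f x\<bar>)"
  unfolding mean_def set_lebesgue_integral_def
  using integral_norm_bound[of M "\<lambda>x. indicator A x *\<^sub>R f x"]
  by (simp add: abs_mult divide_right_mono)

lemma set_integrable_abs_diff_const:
  assumes "A \<in> sets M" "set_integrable M A f"
  shows "set_integrable M A (\<lambda>x. \<bar>f x - c\<bar> :: real)"
  by (intro set_integrable_abs set_integral_diff assms set_integrable_const)

lemma abs_mean_diff_const_le:
  assumes "A \<in> sets M" "measure M A \<noteq> 0" "set_integrable M A f"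
  shows "\<bar>mean M A f - c\<bar> \<le> mean M A (\<lambda>x. \<bar>f x - c\<bar>)"
proof -
  have "mean M A f - c = mean M A (\<lambda>x. f x - c)"
    using assms by (simp add: mean_diff mean_const set_integrable_const)
  then show ?thesis
    using abs_mean_le[of A "\<lambda>x. f x - c"] assms
    by (simp add: set_integral_diff set_integrable_const)
qed

lemma mean_abs_diff_triangle:
  assumes "A \<in> sets M" "measure M A \<noteq> 0" "set_integrable M A f"
  shows "mean M A (\<lambda>x. \<bar>f x - c\<bar>) \<le> mean M A (\<lambda>x. \<bar>f x - d\<bar>) + \<bar>d - c\<bar>"
proof -
  have "mean M A (\<lambda>x. \<bar>f x - c\<bar>) \<le> mean M A (\<lambda>x. \<bar>f x - d\<bar> + \<bar>d - c\<bar>)"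
    by (intro mean_mono set_integral_add set_integrable_abs_diff_const set_integrable_const assms) auto
  also have "\<dots> = mean M A (\<lambda>x. \<bar>f x - d\<bar>) + \<bar>d - c\<bar>"
    using assms by (simp add: mean_add mean_const set_integrable_abs_diff_const set_integrable_const)
  finally show ?thesis .
qed

text \<open>Recentring from the mean to \<open>c\<close> costs their distance, which is itself at
  most the mean deviation from \<open>c\<close>; hence the factor 2.\<close>

lemma oscillation_le:
  assumes "A \<in> sets M" "measure M A \<noteq> 0" "set_integrable M A f"
  shows "oscillation M A f \<le> 2 * mean M A (\<lambda>x. \<bar>f x - c\<bar>)"
  using mean_abs_diff_triangle[OF assms, of "mean M A f" c] abs_mean_diff_const_le[OF assms, of c]
  unfolding oscillation_def by (simp add: abs_minus_commute)

end

text \<open>With this ratio the total measure of the stopping cubes halves the Hoelder factor, so that the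
  constant below solves \<open>C = (stop_ratio + 1) + C / 2\<close>.\<close>

definition stop_ratio :: "real \<Rightarrow> real" where "stop_ratio p = 2 powr (p / (p - 1))"

definition JN_const :: "real \<Rightarrow> real" where "JN_const p = 2 * (stop_ratio p + 1)"

lemma stop_ratio_ge_1: "1 < p \<Longrightarrow> 1 \<le> stop_ratio p"
  unfolding stop_ratio_def by (intro ge_one_powr_ge_zero) auto

lemma stop_ratio_powr:
  assumes "1 < p"
  shows "(1 / stop_ratio p) powr (1 - 1/p) = 1/2"
proof -
  have "p / (p - 1) * (1 - 1/p) = 1" using assms by (simp add: divide_simps)
  then show ?thesis unfolding stop_ratio_def by (simp only: powr_divide powr_powr) simp
qed

section \<open>Packings in a countable nested family\<close>

text \<open>Abstract dyadic structure. Countability gives measurability of suprema and exhaustion by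
  finite subfamilies; positive measure makes means genuine averages and excludes the empty
  set.\<close>

locale nested_family = finite_measure M for M :: "'a measure" +
  fixes D :: "'a set set"
  assumes countable: "countable D"
    and sets: "Q \<in> D \<Longrightarrow> Q \<in> sets M"
    and measure_pos: "Q \<in> D \<Longrightarrow> 0 < measure M Q"
    and nested: "Q \<in> D \<Longrightarrow> R \<in> D \<Longrightarrow> Q \<inter> R = {} \<or> Q \<subseteq> R \<or> R \<subseteq> Q"
begin

lemma nonempty: "Q \<in> D \<Longrightarrow> Q \<noteq> {}"
  using measure_pos by fastforce

text \<open>Only finite packings occur here: a sum of nonnegative terms over a countable collection
  is the supremum of its finite partial sums.\<close>

definition packings :: "'a set \<Rightarrow> 'a set set set" where
  "packings A = {C. finite C \<and> C \<subseteq> D \<and> disjoint C \<and> (\<forall>R\<in>C. R \<subseteq> A)}"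

lemma empty_packing: "{} \<in> packings A"
  by (simp add: packings_def)

lemma packings_mono: "A \<subseteq> B \<Longrightarrow> packings A \<subseteq> packings B"
  by (auto simp: packings_def)

text \<open>Packings of disjoint sets glue together. They share no member, since a common member
  would be disjoint from itself, hence empty; a sum over the union therefore splits.\<close>

lemma packings_UN:
  assumes G: "finite G" "disjoint G" and c: "\<And>Q. Q \<in> G \<Longrightarrow> c Q \<in> packings Q"
  shows "(\<Union>Q\<in>G. c Q) \<in> packings (\<Union>G)"
    and "Q \<in> G \<Longrightarrow> R \<in> G \<Longrightarrow> Q \<noteq> R \<Longrightarrow> c Q \<inter> c R = {}"
proof -
  have *: "X \<inter> Y = {}" if "Q \<in> G" "R \<in> G" "Q \<noteq> R" "X \<in> c Q" "Y \<in> c R" for Q R X Y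
  proof -
    have "X \<subseteq> Q" "Y \<subseteq> R" using c that unfolding packings_def by blast+
    moreover have "Q \<inter> R = {}" using G(2) that by (simp add: pairwise_def disjnt_def)
    ultimately show ?thesis by blast
  qed
  show "(\<Union>Q\<in>G. c Q) \<in> packings (\<Union>G)"
    unfolding packings_def
  proof (intro CollectI conjI)
    show "disjoint (\<Union>Q\<in>G. c Q)"
    proof (intro pairwiseI)
      fix X Y assume "X \<in> (\<Union>Q\<in>G. c Q)" "Y \<in> (\<Union>Q\<in>G. c Q)" "X \<noteq> Y"
      then obtain Q R where "Q \<in> G" "R \<in> G" "X \<in> c Q" "Y \<in> c R" by blast
      show "disjnt X Y"
      proof (cases "Q = R")
        case True
        have "disjoint (c Q)" using c[OF \<open>Q \<in> G\<close>] by (simp add: packings_def)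
        with True \<open>X \<in> c Q\<close> \<open>Y \<in> c R\<close> \<open>X \<noteq> Y\<close> show ?thesis by (simp add: pairwise_def)
      next
        case False
        then show ?thesis
          using *[OF \<open>Q \<in> G\<close> \<open>R \<in> G\<close> _ \<open>X \<in> c Q\<close> \<open>Y \<in> c R\<close>] by (simp add: disjnt_def)
      qed
    qed
    show "finite (\<Union>Q\<in>G. c Q)" using c G(1) by (simp add: packings_def)
    show "(\<Union>Q\<in>G. c Q) \<subseteq> D" using c unfolding packings_def by blast
    show "\<forall>R\<in>(\<Union>Q\<in>G. c Q). R \<subseteq> \<Union>G" using c unfolding packings_def by blast
  qed
  show "c Q \<inter> c R = {}" if "Q \<in> G" "R \<in> G" "Q \<noteq> R"
  proof (rule ccontr)
    assume "c Q \<inter> c R \<noteq> {}"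
    then obtain X where X: "X \<in> c Q" "X \<in> c R" by blast
    then have "X \<in> D" using c[OF that(1)] by (auto simp: packings_def)
    with *[OF that X] nonempty show False by blast
  qed
qed

end

section \<open>The localised John-Nirenberg functional\<close>

locale JN_function = nested_family +
  fixes f :: "'a \<Rightarrow> real" and p :: real
  assumes integrable: "integrable M f"
    and p_gt_1: "1 < p"
    and bounded: "bdd_above ((\<lambda>C. \<Sum>R\<in>C. measure M R * oscillation M R f powr p) ` packings (space M))"
begin

text \<open>The \<open>p\<close>-th power of the John-Nirenberg norm localised to \<open>A\<close>.
  The supremum is taken in the reals, so for \<open>A\<close> inside the space the assumption
  \<open>bounded\<close> is what makes it meaningful.\<close>

definition JN :: "'a set \<Rightarrow> real" where
  "JN A = (SUP C\<in>packings A. \<Sum>R\<in>C. measure M R * oscillation M R f powr p)"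

lemma integrable_on: "Q \<in> sets M \<Longrightarrow> set_integrable M Q f"
  unfolding set_integrable_def using integrable integrable_mult_indicator by blast

lemma subset_space: "Q \<in> D \<Longrightarrow> Q \<subseteq> space M"
  using sets sets.sets_into_space by blast

lemma bounded_on:
  "A \<subseteq> space M \<Longrightarrow> bdd_above ((\<lambda>C. \<Sum>R\<in>C. measure M R * oscillation M R f powr p) ` packings A)"
  by (rule bdd_above_mono[OF bounded]) (auto dest: packings_mono)

lemma JN_upper:
  assumes "A \<subseteq> space M" "C \<in> packings A"
  shows "(\<Sum>R\<in>C. measure M R * oscillation M R f powr p) \<le> JN A"
  unfolding JN_def by (rule cSUP_upper[OF assms(2) bounded_on[OF assms(1)]])

lemma JN_nonneg: "A \<subseteq> space M \<Longrightarrow> 0 \<le> JN A"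
  using JN_upper[OF _ empty_packing] by simp

lemma oscillation_le_JN: "Q \<in> D \<Longrightarrow> measure M Q * oscillation M Q f powr p \<le> JN Q"
  using JN_upper[of Q "{Q}"] subset_space by (simp add: packings_def)

text \<open>Nearly optimal packings of the disjoint sets glue to a packing of \<open>A\<close>; the
  loss in the choice is arbitrarily small.\<close>

lemma JN_superadditive:
  assumes G: "finite G" "disjoint G" "G \<subseteq> D" and A: "\<Union>G \<subseteq> A" "A \<subseteq> space M"
  shows "(\<Sum>Q\<in>G. JN Q) \<le> JN A"
proof (rule field_le_epsilon)
  fix e :: real assume "0 < e"
  \<comment> \<open>The error \<open>e\<close> is shared among the members of \<open>G\<close>; the
    \<open>+ 1\<close> keeps the denominator positive when \<open>G\<close> is empty.\<close>
  define d where "d = e / (card G + 1)"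
  have "0 < d" using \<open>0 < e\<close> by (simp add: d_def add_pos_nonneg)
  have "\<exists>C\<in>packings Q. JN Q - d < (\<Sum>R\<in>C. measure M R * oscillation M R f powr p)" if "Q \<in> G" for Q
  proof -
    have "packings Q \<noteq> {}" using empty_packing by blast
    moreover have "JN Q - d < JN Q" using \<open>0 < d\<close> by simp
    moreover have "Q \<subseteq> space M" using that G(3) subset_space by blast
    ultimately show ?thesis
      using less_cSUP_iff[OF _ bounded_on] unfolding JN_def by blast
  qed
  then obtain c where c: "\<And>Q. Q \<in> G \<Longrightarrow> c Q \<in> packings Q"
    "\<And>Q. Q \<in> G \<Longrightarrow> JN Q - d < (\<Sum>R\<in>c Q. measure M R * oscillation M R f powr p)"
    by metis
  have "(\<Sum>Q\<in>G. JN Q) - e \<le> (\<Sum>Q\<in>G. JN Q - d)"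
  proof -
    have "card G * d \<le> e" using \<open>0 < e\<close> by (simp add: d_def field_simps)
    then show ?thesis by (simp add: sum_subtractf)
  qed
  also have "\<dots> \<le> (\<Sum>Q\<in>G. \<Sum>R\<in>c Q. measure M R * oscillation M R f powr p)"
    by (intro sum_mono less_imp_le c(2))
  also have "\<dots> = (\<Sum>R\<in>(\<Union>Q\<in>G. c Q). measure M R * oscillation M R f powr p)"
  proof (rule sum.UNION_disjoint[symmetric])
    show "\<forall>Q\<in>G. finite (c Q)" using c(1) by (simp add: packings_def)
    show "\<forall>Q\<in>G. \<forall>R\<in>G. Q \<noteq> R \<longrightarrow> c Q \<inter> c R = {}"
      using packings_UN(2)[where c = c, OF G(1,2) c(1)] by simp
  qed (rule G(1))
  also have "\<dots> \<le> JN A"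
    using packings_UN(1)[where c = c, OF G(1,2) c(1)] packings_mono[OF A(1)] by (intro JN_upper A(2)) auto
  finally show "(\<Sum>Q\<in>G. JN Q) \<le> JN A + e" by simp
qed

text \<open>The one-element packing \<open>{Q}\<close> already bounds the oscillation; splitting the
  measure into its powers \<open>1 - 1/p\<close> and \<open>1/p\<close> gives the scale of the main
  estimate.\<close>

lemma JN_root_bound:
  assumes "Q \<in> D"
  shows "measure M Q * oscillation M Q f \<le> measure M Q powr (1 - 1/p) * JN Q powr (1/p)"
proof -
  have "measure M Q * oscillation M Q f
      = measure M Q powr (1 - 1/p) * (measure M Q * oscillation M Q f powr p) powr (1/p)"
    using p_gt_1 measure_pos[OF assms] oscillation_nonneg[of M Q f]
    by (simp add: powr_mult powr_powr mult.assoc[symmetric] flip: powr_add)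
  also have "\<dots> \<le> measure M Q powr (1 - 1/p) * JN Q powr (1/p)"
    using p_gt_1 oscillation_nonneg[of M Q f] oscillation_le_JN[OF assms]
    by (intro mult_left_mono powr_mono2) auto
  finally show ?thesis .
qed

section \<open>The integral of the local maximal function\<close>

text \<open>The function \<open>T\<close> of the outline, restricted to a subfamily \<open>F\<close>
  so that finite families can be treated first. The indicator replaces the condition that
  \<open>x\<close> lies in \<open>R\<close>, so the index set does not vary with
  \<open>x\<close>.\<close>

definition local_max :: "'a set set \<Rightarrow> 'a set \<Rightarrow> 'a \<Rightarrow> ennreal" where
  "local_max F Q x =
     (SUP R\<in>{R\<in>F. R \<subseteq> Q}. ennreal (mean M R (\<lambda>y. \<bar>f y - mean M Q f\<bar>)) * indicator R x)"

lemma local_max_measurable [measurable]: "F \<subseteq> D \<Longrightarrow> local_max F Q \<in> borel_measurable M"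
  unfolding local_max_def[abs_def]
proof (rule borel_measurable_SUP)
  assume "F \<subseteq> D"
  then show "Countable_Set.countable {R \<in> F. R \<subseteq> Q}"
    by (intro countable_subset[OF _ countable]) auto
  fix R assume "R \<in> {R \<in> F. R \<subseteq> Q}"
  with \<open>F \<subseteq> D\<close> have "R \<in> sets M" using sets by blast
  then show "(\<lambda>x. ennreal (mean M R (\<lambda>y. \<bar>f y - mean M Q f\<bar>)) * indicator R x) \<in> borel_measurable M"
    by measurable
qed

lemma local_max_upper:
  "R \<in> F \<Longrightarrow> R \<subseteq> Q \<Longrightarrow> x \<in> R \<Longrightarrow> ennreal (mean M R (\<lambda>y. \<bar>f y - mean M Q f\<bar>)) \<le> local_max F Q x"
  unfolding local_max_def by (rule SUP_upper2[of R]) auto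

text \<open>Strong induction on the number of members of \<open>F\<close> inside \<open>Q\<close>.
  Finiteness supplies maximal stopping sets, and the constant is independent of \<open>F\<close>,
  which allows a later passage to the limit.\<close>

lemma integral_local_max_finite:
  assumes "finite F" "F \<subseteq> D" "Q \<in> F"
  shows "(\<integral>\<^sup>+x. local_max F Q x \<partial>M)
    \<le> ennreal (JN_const p * (measure M Q powr (1 - 1/p) * JN Q powr (1/p)))"
  using assms(3)
proof (induction "card {R\<in>F. R \<subseteq> Q}" arbitrary: Q rule: less_induct)
  case less
  define c where "c = mean M Q f"
  define osc where "osc = oscillation M Q f"
  define r where "r = stop_ratio p"
  define dev where "dev R = mean M R (\<lambda>y. \<bar>f y - c\<bar>)" for R
  define Bad where "Bad = {R\<in>F. R \<subseteq> Q \<and> r * osc < dev R}"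
  define G where "G = {R\<in>Bad. \<forall>R'\<in>Bad. R \<subseteq> R' \<longrightarrow> R' = R}"
  have QD: "Q \<in> D" using less.prems assms by blast
  have Qs: "Q \<in> sets M" "Q \<subseteq> space M" "0 < measure M Q"
    using QD sets subset_space measure_pos by auto
  have "1 \<le> r" unfolding r_def by (rule stop_ratio_ge_1[OF p_gt_1])
  have "0 \<le> osc" unfolding osc_def by (rule oscillation_nonneg)
  have devQ: "dev Q = osc" by (simp add: dev_def osc_def c_def oscillation_def)
  have "osc \<le> r * osc" using \<open>1 \<le> r\<close> \<open>0 \<le> osc\<close> by (simp add: mult_right_le_one_le mult_le_cancel_right1)
  \<comment> \<open>Since \<open>Q\<close> does not stop itself, every stopping set is strictly
    smaller, and the induction hypothesis will apply to it.\<close>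
  then have "Q \<notin> Bad" by (simp add: Bad_def devQ)
  have GF: "G \<subseteq> F" "G \<subseteq> Bad" by (auto simp: G_def Bad_def)
  have finG: "finite G" using GF assms(1) finite_subset by blast
  have GD: "G \<subseteq> D" using GF assms(2) by blast
  have Gs: "S \<in> sets M" "0 < measure M S" "set_integrable M S f" if "S \<in> G" for S
    using that GD sets measure_pos integrable_on by blast+
  \<comment> \<open>Two stopping sets that meet would be nested, and maximality would make them
    equal.\<close>
  have disj: "disjoint G"
  proof (rule pairwiseI)
    fix R S assume "R \<in> G" "S \<in> G" "R \<noteq> S"
    then show "disjnt R S" using nested[of R S] GD unfolding G_def disjnt_def by blast
  qed
  have GQ: "\<Union>G \<subseteq> Q" by (auto simp: G_def Bad_def)
  have total: "(\<Sum>S\<in>G. measure M S * dev S) \<le> measure M Q * osc"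
  proof -
    have "(\<Sum>S\<in>G. measure M S * dev S) = (\<Sum>S\<in>G. LINT x:S|M. \<bar>f x - c\<bar>)"
    proof (rule sum.cong)
      show "measure M S * dev S = (LINT x:S|M. \<bar>f x - c\<bar>)" if "S \<in> G" for S
        unfolding dev_def using Gs(2)[OF that] by (intro measure_times_mean) simp
    qed simp
    also have "\<dots> \<le> (LINT x:Q|M. \<bar>f x - c\<bar>)"
    proof (rule sum_set_integral_disjoint_le[OF finG disj _ GQ Qs(1)])
      show "set_integrable M Q (\<lambda>x. \<bar>f x - c\<bar>)"
        by (intro set_integrable_abs_diff_const integrable_on Qs)
    qed (use Gs in auto)
    also have "\<dots> = measure M Q * osc"
      using measure_times_mean[of M Q "\<lambda>x. \<bar>f x - c\<bar>"] Qs devQ by (simp add: dev_def)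
    finally show ?thesis .
  qed
  \<comment> \<open>Chebyshev's argument: the deviation exceeds \<open>r * osc\<close> on each
    stopping set, while \<open>total\<close> bounds the weighted sum of deviations. If
    \<open>osc = 0\<close>, cancelling is impossible, but then any stopping set would contradict
    \<open>total\<close>.\<close>
  have small: "(\<Sum>S\<in>G. measure M S) \<le> measure M Q / r"
  proof (cases "osc = 0")
    case True
    have "G = {}"
    proof (rule ccontr)
      assume "G \<noteq> {}"
      then have "0 < (\<Sum>S\<in>G. measure M S * dev S)"
        using Gs True GF by (intro sum_pos finG mult_pos_pos) (auto simp: Bad_def)
      with total True show False by simp
    qed
    then show ?thesis using Qs \<open>1 \<le> r\<close> by simp
  next
    case False
    with \<open>0 \<le> osc\<close> have "0 < osc" by simp
    have "(\<Sum>S\<in>G. measure M S) * (r * osc) = (\<Sum>S\<in>G. measure M S * (r * osc))"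
      by (rule sum_distrib_right)
    also have "\<dots> \<le> (\<Sum>S\<in>G. measure M S * dev S)"
      using GF by (intro sum_mono mult_left_mono) (auto simp: Bad_def)
    also note total
    finally have "(\<Sum>S\<in>G. measure M S) * r * osc \<le> measure M Q * osc" by (simp add: mult.assoc)
    then have "(\<Sum>S\<in>G. measure M S) * r \<le> measure M Q" using \<open>0 < osc\<close> by simp
    then show ?thesis using \<open>1 \<le> r\<close> by (simp add: pos_le_divide_eq)
  qed
  have pointwise: "local_max F Q x \<le> ennreal (r * osc) * indicator Q x
      + (\<Sum>S\<in>G. ennreal (dev S) * indicator S x + local_max F S x)" for x
    unfolding local_max_def[of F Q]
  proof (rule SUP_least)
    fix R assume "R \<in> {R \<in> F. R \<subseteq> Q}"
    then have R: "R \<in> F" "R \<subseteq> Q" by auto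
    show "ennreal (mean M R (\<lambda>y. \<bar>f y - mean M Q f\<bar>)) * indicator R x \<le> ennreal (r * osc) * indicator Q x
      + (\<Sum>S\<in>G. ennreal (dev S) * indicator S x + local_max F S x)"
    proof (cases "x \<in> R")
      case True
      then have x: "x \<in> Q" using R by blast
      show ?thesis
      proof (cases "R \<in> Bad")
        case False
        then have "dev R \<le> r * osc" using R by (auto simp: Bad_def)
        then have "ennreal (dev R) \<le> ennreal (r * osc)" by (rule ennreal_leI)
        also have "\<dots> \<le> ennreal (r * osc) + (\<Sum>S\<in>G. ennreal (dev S) * indicator S x + local_max F S x)"
          by simp
        finally show ?thesis using True x by (simp add: dev_def c_def)
      next
        case bad: True
        have "finite Bad" using assms(1) by (simp add: Bad_def)
        with bad obtain S where S: "S \<in> Bad" "R \<subseteq> S" "\<forall>R'\<in>Bad. S \<subseteq> R' \<longrightarrow> S = R'"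
          using finite_has_maximal2[of Bad R] by blast
        then have "S \<in> G" by (auto simp: G_def)
        have RD: "R \<in> D" using R assms by blast
        \<comment> \<open>Recentre from \<open>c\<close> to the mean over the stopping set
          \<open>S\<close> above \<open>R\<close>: the new deviation is one of those in
          \<open>local_max F S\<close>, and the shift costs at most \<open>dev S\<close>.\<close>
        have "dev R \<le> mean M R (\<lambda>y. \<bar>f y - mean M S f\<bar>) + \<bar>mean M S f - c\<bar>"
          unfolding dev_def using RD sets[OF RD] measure_pos[OF RD]
          by (intro mean_abs_diff_triangle integrable_on) auto
        also have "\<bar>mean M S f - c\<bar> \<le> dev S"
          unfolding dev_def using Gs[OF \<open>S \<in> G\<close>] by (intro abs_mean_diff_const_le) auto
        finally have "ennreal (dev R) \<le> ennreal (dev S + mean M R (\<lambda>y. \<bar>f y - mean M S f\<bar>))"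
          by (intro ennreal_leI) simp
        also have "\<dots> = ennreal (dev S) + ennreal (mean M R (\<lambda>y. \<bar>f y - mean M S f\<bar>))"
          by (intro ennreal_plus) (auto simp: dev_def intro!: mean_nonneg)
        also have "\<dots> \<le> ennreal (dev S) * indicator S x + local_max F S x"
          using True S R by (intro add_mono local_max_upper) auto
        also have "\<dots> \<le> (\<Sum>S\<in>G. ennreal (dev S) * indicator S x + local_max F S x)"
          by (rule member_le_sum[OF \<open>S \<in> G\<close> _ finG]) simp
        also have "\<dots> \<le> ennreal (r * osc) * indicator Q x + \<dots>" by simp
        finally show ?thesis using True by (simp add: dev_def c_def)
      qed
    qed simp
  qed
  have IH: "(\<integral>\<^sup>+x. local_max F S x \<partial>M)
      \<le> ennreal (JN_const p * (measure M S powr (1 - 1/p) * JN S powr (1/p)))" if "S \<in> G" for S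
  proof (rule less.hyps)
    show "S \<in> F" using that GF by blast
    have "S \<subset> Q" using that GF \<open>Q \<notin> Bad\<close> by (auto simp: Bad_def)
    then have "{R \<in> F. R \<subseteq> S} \<subset> {R \<in> F. R \<subseteq> Q}" using less.prems by blast
    then show "card {R \<in> F. R \<subseteq> S} < card {R \<in> F. R \<subseteq> Q}"
      using assms(1) by (intro psubset_card_mono) auto
  qed
  define E where "E = measure M Q powr (1 - 1/p) * JN Q powr (1/p)"
  have "0 \<le> E" by (simp add: E_def)
  have C: "0 \<le> JN_const p" using \<open>1 \<le> r\<close> by (simp add: JN_const_def r_def)
  have "(\<integral>\<^sup>+x. local_max F Q x \<partial>M) \<le> (\<integral>\<^sup>+x. ennreal (r * osc) * indicator Q x
      + (\<Sum>S\<in>G. ennreal (dev S) * indicator S x + local_max F S x) \<partial>M)"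
    by (rule nn_integral_mono) (rule pointwise)
  also have "\<dots> = ennreal (r * osc) * emeasure M Q
      + (\<Sum>S\<in>G. ennreal (dev S) * emeasure M S + (\<integral>\<^sup>+x. local_max F S x \<partial>M))"
    using Gs(1) Qs assms(2)
    by (simp add: nn_integral_add nn_integral_sum nn_integral_cmult_indicator local_max_measurable)
  also have "\<dots> \<le> ennreal (r * osc) * emeasure M Q
      + (\<Sum>S\<in>G. ennreal (dev S) * emeasure M S
          + ennreal (JN_const p * (measure M S powr (1 - 1/p) * JN S powr (1/p))))"
    by (intro add_mono sum_mono IH order_refl)
  also have "\<dots> = ennreal (r * osc * measure M Q
      + (\<Sum>S\<in>G. dev S * measure M S + JN_const p * (measure M S powr (1 - 1/p) * JN S powr (1/p))))"
  proof -
    have "0 \<le> dev S" for S by (simp add: dev_def mean_nonneg)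
    then have nn: "0 \<le> dev S * measure M S + JN_const p * (measure M S powr (1 - 1/p) * JN S powr (1/p))"
      for S using C by simp
    have "ennreal (r * osc) * emeasure M Q + (\<Sum>S\<in>G. ennreal (dev S) * emeasure M S
          + ennreal (JN_const p * (measure M S powr (1 - 1/p) * JN S powr (1/p))))
      = ennreal (r * osc * measure M Q) + (\<Sum>S\<in>G. ennreal (dev S * measure M S
          + JN_const p * (measure M S powr (1 - 1/p) * JN S powr (1/p))))"
      using C \<open>0 \<le> osc\<close> \<open>1 \<le> r\<close> \<open>\<And>S. 0 \<le> dev S\<close>
      by (simp add: emeasure_eq_measure flip: ennreal_mult'')
    also have "\<dots> = ennreal (r * osc * measure M Q) + ennreal (\<Sum>S\<in>G. dev S * measure M S
          + JN_const p * (measure M S powr (1 - 1/p) * JN S powr (1/p)))"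
      using nn by (subst sum_ennreal) auto
    also have "\<dots> = ennreal (r * osc * measure M Q + (\<Sum>S\<in>G. dev S * measure M S
          + JN_const p * (measure M S powr (1 - 1/p) * JN S powr (1/p))))"
      using nn \<open>0 \<le> osc\<close> \<open>1 \<le> r\<close> by (intro ennreal_plus[symmetric] sum_nonneg) auto
    finally show ?thesis .
  qed
  also have "\<dots> \<le> ennreal (JN_const p * E)"
  proof (rule ennreal_leI)
    have "(\<Sum>S\<in>G. measure M S powr (1 - 1/p) * JN S powr (1/p))
        \<le> (\<Sum>S\<in>G. measure M S) powr (1 - 1/p) * (\<Sum>S\<in>G. JN S) powr (1/p)"
    proof (rule Holder_inequality_sum_powr)
      show "0 \<le> JN S" if "S \<in> G" for S using that GD by (intro JN_nonneg subset_space) auto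
    qed (use p_gt_1 in auto)
    \<comment> \<open>The small total measure is where the contraction comes from: the factor
      \<open>(1 / r) powr (1 - 1/p)\<close> equals 1/2 by the choice of
      \<open>stop_ratio\<close>.\<close>
    also have "\<dots> \<le> (measure M Q / r) powr (1 - 1/p) * JN Q powr (1/p)"
    proof (intro mult_mono powr_mono2 small)
      show "(\<Sum>S\<in>G. JN S) \<le> JN Q" by (rule JN_superadditive[OF finG disj GD GQ Qs(2)])
      show "0 \<le> (\<Sum>S\<in>G. JN S)" using GD by (intro sum_nonneg JN_nonneg subset_space) auto
      show "0 \<le> (\<Sum>S\<in>G. measure M S)" by (simp add: sum_nonneg)
    qed (use p_gt_1 in auto)
    also have "\<dots> = (1 / r) powr (1 - 1/p) * E"
      using Qs \<open>1 \<le> r\<close> by (simp add: E_def powr_divide)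
    also have "\<dots> = E / 2" unfolding r_def stop_ratio_powr[OF p_gt_1] by simp
    finally have 1: "JN_const p * (\<Sum>S\<in>G. measure M S powr (1 - 1/p) * JN S powr (1/p)) \<le> JN_const p * (E / 2)"
      using C by (rule mult_left_mono)
    have 2: "measure M Q * osc \<le> E" unfolding E_def osc_def by (rule JN_root_bound[OF QD])
    then have "r * (measure M Q * osc) \<le> r * E" using \<open>1 \<le> r\<close> by (intro mult_left_mono) auto
    \<comment> \<open>The good part, the deviations and the recursive part contribute at most
      \<open>r\<close>, \<open>1\<close> and \<open>JN_const p / 2\<close> times \<open>E\<close>;
      with \<open>JN_const p = 2 * (r + 1)\<close> these add up exactly.\<close>
    with 1 2 total show "r * osc * measure M Q
      + (\<Sum>S\<in>G. dev S * measure M S + JN_const p * (measure M S powr (1 - 1/p) * JN S powr (1/p)))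
      \<le> JN_const p * E"
      by (simp add: sum.distrib sum_distrib_left JN_const_def r_def[symmetric] algebra_simps)
  qed
  finally show ?case unfolding E_def .
qed

text \<open>Monotone convergence along finite subfamilies exhausting \<open>D\<close>, with the
  uniform bound of the finite case.\<close>

lemma integral_local_max:
  assumes "Q \<in> D"
  shows "(\<integral>\<^sup>+x. local_max D Q x \<partial>M)
    \<le> ennreal (JN_const p * (measure M Q powr (1 - 1/p) * JN Q powr (1/p)))"
proof -
  \<comment> \<open>\<open>Q\<close> is inserted at every stage because the finite estimate requires
    it to belong to the family.\<close>
  define F where "F n = insert Q (from_nat_into D ` {..n})" for n :: nat
  have "D \<noteq> {}" using assms by blast
  have FD: "F n \<subseteq> D" for n
    using assms from_nat_into[OF \<open>D \<noteq> {}\<close>] by (auto simp: F_def)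
  have UF: "(\<Union>n. F n) = D"
  proof
    show "D \<subseteq> (\<Union>n. F n)"
    proof
      fix R assume "R \<in> D"
      then obtain n where "R = from_nat_into D n" using from_nat_into_surj[OF countable] by metis
      then have "R \<in> F n" by (auto simp: F_def)
      then show "R \<in> (\<Union>n. F n)" by blast
    qed
  qed (use FD in blast)
  have "local_max D Q x = (SUP n. local_max (F n) Q x)" for x
  proof -
    have "{R \<in> D. R \<subseteq> Q} = (\<Union>n. {R \<in> F n. R \<subseteq> Q})" using UF by blast
    then show ?thesis unfolding local_max_def by (simp only: SUP_UNION)
  qed
  then have "(\<integral>\<^sup>+x. local_max D Q x \<partial>M) = (\<integral>\<^sup>+x. (SUP n. local_max (F n) Q x) \<partial>M)" by simp
  also have "\<dots> = (SUP n. \<integral>\<^sup>+x. local_max (F n) Q x \<partial>M)"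
  proof (rule nn_integral_monotone_convergence_SUP)
    show "incseq (\<lambda>n. local_max (F n) Q)"
    proof (intro incseq_SucI le_funI)
      show "local_max (F n) Q x \<le> local_max (F (Suc n)) Q x" for n x
        unfolding local_max_def by (rule SUP_subset_mono) (auto simp: F_def)
    qed
  qed (rule local_max_measurable[OF FD])
  also have "\<dots> \<le> ennreal (JN_const p * (measure M Q powr (1 - 1/p) * JN Q powr (1/p)))"
    by (intro SUP_least integral_local_max_finite FD) (auto simp: F_def)
  finally show ?thesis .
qed

section \<open>Oscillation of the maximal function\<close>

definition maximal :: "'a \<Rightarrow> ennreal" where
  "maximal x = (SUP R\<in>D. ennreal (mean M R (\<lambda>y. \<bar>f y\<bar>)) * indicator R x)"

lemma maximal_measurable [measurable]: "maximal \<in> borel_measurable M"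
  unfolding maximal_def[abs_def]
proof (rule borel_measurable_SUP[OF countable])
  fix R assume "R \<in> D"
  then have "R \<in> sets M" by (rule sets)
  then show "(\<lambda>x. ennreal (mean M R (\<lambda>y. \<bar>f y\<bar>)) * indicator R x) \<in> borel_measurable M"
    by measurable
qed

text \<open>A member of \<open>D\<close> through a point of \<open>Q\<close> either contains
  \<open>Q\<close>, and its mean is at most \<open>a\<close>, or lies in \<open>Q\<close>, and then
  centring at the mean of \<open>f\<close> over \<open>Q\<close> leaves a deviation counted in
  \<open>local_max D Q\<close>.\<close>

lemma maximal_bounds:
  assumes Q: "Q \<in> D"
  obtains a where "0 \<le> a"
    "\<And>x. x \<in> Q \<Longrightarrow> ennreal a \<le> maximal x"
    "\<And>x. x \<in> Q \<Longrightarrow> maximal x \<le> ennreal a + local_max D Q x"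
proof -
  define a where "a = (SUP R\<in>{R\<in>D. Q \<subseteq> R}. ennreal (mean M R (\<lambda>y. \<bar>f y\<bar>)))"
  \<comment> \<open>Sets containing \<open>Q\<close> have at least its measure, so their means share
    one finite bound; this makes \<open>a\<close> a real number.\<close>
  have "a \<le> ennreal ((LINT y|M. \<bar>f y\<bar>) / measure M Q)"
    unfolding a_def
  proof (intro SUP_least ennreal_leI)
    fix R assume "R \<in> {R \<in> D. Q \<subseteq> R}"
    then have R: "R \<in> D" "Q \<subseteq> R" by auto
    have "(LINT y:R|M. \<bar>f y\<bar>) \<le> (LINT y|M. \<bar>f y\<bar>)"
      unfolding set_lebesgue_integral_def
      using integrable sets[OF R(1)]
      by (intro integral_mono integrable_mult_indicator) (auto simp: indicator_def)
    moreover have "measure M Q \<le> measure M R"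
      using R sets by (intro finite_measure_mono) auto
    ultimately show "mean M R (\<lambda>y. \<bar>f y\<bar>) \<le> (LINT y|M. \<bar>f y\<bar>) / measure M Q"
      unfolding mean_def using measure_pos[OF Q] by (intro frac_le) auto
  qed
  then have fin: "a < \<infinity>" using le_less_trans ennreal_less_top by fastforce
  have lower: "a \<le> maximal x" if "x \<in> Q" for x
    unfolding a_def maximal_def
  proof (rule SUP_mono)
    show "\<exists>S\<in>D. ennreal (mean M R (\<lambda>y. \<bar>f y\<bar>)) \<le> ennreal (mean M S (\<lambda>y. \<bar>f y\<bar>)) * indicator S x"
      if "R \<in> {R \<in> D. Q \<subseteq> R}" for R
      using that \<open>x \<in> Q\<close> by (intro bexI[of _ R]) auto
  qed
  have upper: "maximal x \<le> a + local_max D Q x" if x: "x \<in> Q" for x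
    unfolding maximal_def
  proof (rule SUP_least)
    fix R assume R: "R \<in> D"
    show "ennreal (mean M R (\<lambda>y. \<bar>f y\<bar>)) * indicator R x \<le> a + local_max D Q x"
    proof (cases "x \<in> R")
      case True
      with x nested[OF Q R] consider "Q \<subseteq> R" | "R \<subseteq> Q" by blast
      then show ?thesis
      proof cases
        case 1
        then have "ennreal (mean M R (\<lambda>y. \<bar>f y\<bar>)) \<le> a"
          unfolding a_def using R by (intro SUP_upper) auto
        with True show ?thesis by (simp add: add_increasing2)
      next
        case 2
        \<comment> \<open>Writing the absolute value as a deviation from 0 turns the estimate into a
          change of centre.\<close>
        have "mean M R (\<lambda>y. \<bar>f y - 0\<bar>) \<le> mean M R (\<lambda>y. \<bar>f y - mean M Q f\<bar>) + \<bar>mean M Q f - 0\<bar>"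
          using sets[OF R] measure_pos[OF R] by (intro mean_abs_diff_triangle integrable_on) auto
        moreover have "\<bar>mean M Q f - 0\<bar> \<le> mean M Q (\<lambda>y. \<bar>f y - 0\<bar>)"
          using sets[OF Q] measure_pos[OF Q] by (intro abs_mean_diff_const_le integrable_on) auto
        ultimately have "ennreal (mean M R (\<lambda>y. \<bar>f y\<bar>))
            \<le> ennreal (mean M Q (\<lambda>y. \<bar>f y\<bar>) + mean M R (\<lambda>y. \<bar>f y - mean M Q f\<bar>))"
          by (intro ennreal_leI) simp
        also have "\<dots> = ennreal (mean M Q (\<lambda>y. \<bar>f y\<bar>)) + ennreal (mean M R (\<lambda>y. \<bar>f y - mean M Q f\<bar>))"
          by (intro ennreal_plus mean_nonneg) auto
        also have "\<dots> \<le> a + local_max D Q x"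
        proof (rule add_mono)
          show "ennreal (mean M Q (\<lambda>y. \<bar>f y\<bar>)) \<le> a"
            unfolding a_def using Q by (intro SUP_upper) auto
        qed (rule local_max_upper[OF R 2 True])
        finally show ?thesis using True by simp
      qed
    qed simp
  qed
  obtain b where b: "0 \<le> b" "a = ennreal b" using fin by (cases a) auto
  show thesis
    by (rule that[of b]) (use b lower upper in auto)
qed

text \<open>All three facts follow from \<open>maximal\<close> lying within
  \<open>local_max D Q\<close>, whose integral is bounded, of a constant on
  \<open>Q\<close>.\<close>

lemma
  assumes Q: "Q \<in> D"
  shows AE_maximal_finite: "AE x in M. x \<in> Q \<longrightarrow> maximal x < \<infinity>"
    and set_integrable_maximal: "set_integrable M Q (\<lambda>x. enn2real (maximal x))"
    and oscillation_maximal: "measure M Q * oscillation M Q (\<lambda>x. enn2real (maximal x)) powr p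
      \<le> (2 * JN_const p) powr p * JN Q"
proof -
  obtain a where a: "0 \<le> a" "\<And>x. x \<in> Q \<Longrightarrow> ennreal a \<le> maximal x"
    "\<And>x. x \<in> Q \<Longrightarrow> maximal x \<le> ennreal a + local_max D Q x"
    using maximal_bounds[OF Q] by blast
  define B where "B = JN_const p * (measure M Q powr (1 - 1/p) * JN Q powr (1/p))"
  define h where "h x = enn2real (maximal x)" for x
  define T where "T x = enn2real (local_max D Q x)" for x
  have C: "0 \<le> JN_const p" using stop_ratio_ge_1[OF p_gt_1] by (simp add: JN_const_def)
  have "0 \<le> B" using C by (simp add: B_def)
  have T_meas [measurable]: "local_max D Q \<in> borel_measurable M" by (rule local_max_measurable) simp
  have Qs [measurable]: "Q \<in> sets M" by (rule sets[OF Q])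
  have T_int: "(\<integral>\<^sup>+x. local_max D Q x \<partial>M) \<le> ennreal B"
    unfolding B_def by (rule integral_local_max[OF Q])
  \<comment> \<open>A finite integral forces finiteness almost everywhere, so the real-valued
    \<open>T\<close> differs from \<open>local_max D Q\<close> only on a null set.\<close>
  then have T_fin: "AE x in M. local_max D Q x \<noteq> \<infinity>"
    by (intro nn_integral_PInf_AE) (auto simp: top_unique)
  then have T_eq: "AE x in M. local_max D Q x = ennreal (T x)"
    by eventually_elim (simp add: T_def less_top)
  then have nn: "(\<integral>\<^sup>+x. ennreal (T x) \<partial>M) = (\<integral>\<^sup>+x. local_max D Q x \<partial>M)"
    by (intro nn_integral_cong_AE) auto
  have T_integrable: "integrable M T"
  proof (rule integrableI_nonneg)
    show "(\<integral>\<^sup>+x. ennreal (T x) \<partial>M) < \<infinity>"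
      using nn T_int ennreal_less_top le_less_trans by fastforce
    show "T \<in> borel_measurable M" unfolding T_def[abs_def] by measurable
  qed (simp add: T_def)
  have T_bound: "(LINT x|M. T x) \<le> B"
  proof -
    have "ennreal (LINT x|M. T x) = (\<integral>\<^sup>+x. ennreal (T x) \<partial>M)"
      by (intro nn_integral_eq_integral[symmetric] T_integrable) (simp add: T_def)
    with nn T_int have "ennreal (LINT x|M. T x) \<le> ennreal B" by simp
    then show ?thesis using \<open>0 \<le> B\<close> by simp
  qed
  have *: "AE x in M. x \<in> Q \<longrightarrow> maximal x < \<infinity> \<and> \<bar>h x - a\<bar> \<le> T x"
    using T_eq
  proof eventually_elim
    case (elim x)
    show ?case
    proof
      assume x: "x \<in> Q"
      have "0 \<le> T x" by (simp add: T_def)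
      have le: "maximal x \<le> ennreal (a + T x)"
        using a(3)[OF x] elim a(1) \<open>0 \<le> T x\<close> by simp
      then have fin: "maximal x < \<infinity>" using ennreal_less_top le_less_trans by fastforce
      then have eq: "maximal x = ennreal (h x)" by (simp add: h_def less_top)
      have "0 \<le> h x" by (simp add: h_def)
      have "h x \<le> a + T x" using le a(1) \<open>0 \<le> T x\<close> unfolding eq by (simp del: ennreal_plus)
      moreover have "a \<le> h x" using a(2)[OF x] \<open>0 \<le> h x\<close> unfolding eq by simp
      ultimately show "maximal x < \<infinity> \<and> \<bar>h x - a\<bar> \<le> T x" using fin by simp
    qed
  qed
  then show "AE x in M. x \<in> Q \<longrightarrow> maximal x < \<infinity>" by eventually_elim blast
  have h_meas [measurable]: "h \<in> borel_measurable M" unfolding h_def[abs_def] by measurable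
  have diff_int: "set_integrable M Q (\<lambda>x. \<bar>h x - a\<bar>)"
    unfolding set_integrable_def
  proof (rule Bochner_Integration.integrable_bound[OF T_integrable])
    show "AE x in M. norm (indicator Q x *\<^sub>R \<bar>h x - a\<bar>) \<le> norm (T x)"
      using * by eventually_elim (auto simp: indicator_def)
  qed measurable
  \<comment> \<open>Integrability of \<open>h\<close> is obtained from that of \<open>h - a\<close>,
    constants being integrable over a finite measure.\<close>
  have "set_integrable M Q (\<lambda>x. h x - a)"
    unfolding set_integrable_def
  proof (rule Bochner_Integration.integrable_bound[OF T_integrable])
    show "AE x in M. norm (indicator Q x *\<^sub>R (h x - a)) \<le> norm (T x)"
      using * by eventually_elim (auto simp: indicator_def)
  qed measurable
  from set_integral_add(1)[OF this set_integrable_const[OF Qs, of a]]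
  have h_int: "set_integrable M Q h" by simp
  then show "set_integrable M Q (\<lambda>x. enn2real (maximal x))" unfolding h_def .
  have "(LINT x:Q|M. \<bar>h x - a\<bar>) \<le> (LINT x|M. T x)"
    unfolding set_lebesgue_integral_def
  proof (rule integral_mono_AE)
    show "AE x in M. indicator Q x *\<^sub>R \<bar>h x - a\<bar> \<le> T x"
      using * by eventually_elim (auto simp: indicator_def T_def)
  qed (use diff_int T_integrable in \<open>auto simp: set_integrable_def\<close>)
  also note T_bound
  finally have "mean M Q (\<lambda>x. \<bar>h x - a\<bar>) \<le> B / measure M Q"
    unfolding mean_def by (simp add: divide_right_mono)
  moreover have "oscillation M Q h \<le> 2 * mean M Q (\<lambda>x. \<bar>h x - a\<bar>)"
    using measure_pos[OF Q] by (intro oscillation_le Qs h_int) auto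
  \<comment> \<open>Dividing \<open>B\<close> by the measure leaves the exponent
    \<open>- (1/p)\<close>; its \<open>p\<close>-th power is the reciprocal of the measure and
    cancels the weight in the claim.\<close>
  ultimately have "oscillation M Q h \<le> 2 * JN_const p * (measure M Q powr (- (1/p)) * JN Q powr (1/p))"
    using measure_pos[OF Q] by (simp add: B_def powr_diff powr_minus_divide)
  then have "oscillation M Q h powr p \<le> (2 * JN_const p * (measure M Q powr (- (1/p)) * JN Q powr (1/p))) powr p"
    using p_gt_1 oscillation_nonneg by (intro powr_mono2) auto
  also have "\<dots> = (2 * JN_const p) powr p * (JN Q / measure M Q)"
  proof -
    have "(measure M Q powr (- (1/p)) * JN Q powr (1/p)) powr p = measure M Q powr (-1) * JN Q"
      using p_gt_1 JN_nonneg[OF subset_space[OF Q]] by (simp add: powr_mult powr_powr)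
    also have "\<dots> = JN Q / measure M Q" using measure_pos[OF Q] by (simp add: powr_minus_divide)
    finally have 1: "(measure M Q powr (- (1/p)) * JN Q powr (1/p)) powr p = JN Q / measure M Q" .
    have 2: "(2 * JN_const p * X) powr p = (2 * JN_const p) powr p * X powr p" for X by (rule powr_mult)
    show ?thesis by (simp only: 2 1)
  qed
  finally show "measure M Q * oscillation M Q (\<lambda>x. enn2real (maximal x)) powr p
      \<le> (2 * JN_const p) powr p * JN Q"
    using measure_pos[OF Q] by (simp add: h_def[symmetric] pos_le_divide_eq mult.commute)
qed

lemma packing_oscillation_maximal:
  assumes "C \<in> packings (space M)"
  shows "(\<Sum>Q\<in>C. measure M Q * oscillation M Q (\<lambda>x. enn2real (maximal x)) powr p)
    \<le> (2 * JN_const p) powr p * JN (space M)"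
proof -
  have C: "finite C" "disjoint C" "C \<subseteq> D" "\<Union>C \<subseteq> space M" using assms by (auto simp: packings_def)
  have "(\<Sum>Q\<in>C. measure M Q * oscillation M Q (\<lambda>x. enn2real (maximal x)) powr p)
      \<le> (\<Sum>Q\<in>C. (2 * JN_const p) powr p * JN Q)"
    using C by (intro sum_mono oscillation_maximal) auto
  also have "\<dots> = (2 * JN_const p) powr p * (\<Sum>Q\<in>C. JN Q)" by (simp add: sum_distrib_left)
  also have "\<dots> \<le> (2 * JN_const p) powr p * JN (space M)"
    using C by (intro mult_left_mono JN_superadditive) auto
  finally show ?thesis .
qed

end

section \<open>Dyadic cubes\<close>

definition dyadic_cube :: "real ^ 'n \<Rightarrow> real \<Rightarrow> nat \<Rightarrow> ('n \<Rightarrow> nat) \<Rightarrow> (real ^ 'n) set" where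
  "dyadic_cube a l j k = cube (\<chi> i. a $ i + real (k i) * (l / 2 ^ j)) (l / 2 ^ j)"

lemma mem_cube: "x \<in> cube a l \<longleftrightarrow> (\<forall>i. a $ i \<le> x $ i \<and> x $ i \<le> a $ i + l)"
  by (simp add: cube_def mem_box_cart)

lemma mem_interior_cube: "x \<in> interior (cube a l) \<longleftrightarrow> (\<forall>i. a $ i < x $ i \<and> x $ i < a $ i + l)"
  by (simp add: cube_def mem_box_cart)

lemma cube_eq_cube_iff:
  fixes a b :: "real ^ 'n"
  assumes "0 < l"
  shows "cube a l = cube b m \<longleftrightarrow> a = b \<and> l = m"
proof
  assume eq: "cube a l = cube b m"
  have "a \<in> cube a l" using assms by (simp add: mem_cube)
  then have "a = b \<and> (\<chi> i. a $ i + l) = (\<chi> i. b $ i + m)"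
    using eq unfolding cube_def eq_cbox by blast
  then show "a = b \<and> l = m" by (metis add_left_cancel vec_lambda_beta)
qed simp

text \<open>A cube determines its corner and side, so those quantified in
  \<open>dyadic_level\<close> are the given \<open>a\<close> and \<open>l\<close>.\<close>

lemma dyadic_subcubes_cube:
  fixes a :: "real ^ 'n"
  assumes "0 < l"
  shows "dyadic_subcubes (cube a l) = {dyadic_cube a l j k |j k. \<forall>i. k i < 2 ^ j}"
  using assms
  by (auto simp: dyadic_subcubes_def dyadic_level_def dyadic_cube_def cube_eq_cube_iff[OF assms])

lemma countable_dyadic_subcubes: "is_cube Q0 \<Longrightarrow> countable (dyadic_subcubes Q0)"
proof -
  assume "is_cube Q0"
  then obtain a l where "0 < l" "Q0 = cube a l" unfolding is_cube_def by blast
  then have "dyadic_subcubes Q0 \<subseteq> range (\<lambda>(j, k). dyadic_cube a l j k)"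
    by (auto simp: dyadic_subcubes_cube)
  then show ?thesis by (rule countable_subset) simp
qed

lemma is_cube_dyadic_subcube:
  assumes "is_cube Q0" "Q \<in> dyadic_subcubes Q0"
  shows "is_cube Q"
proof -
  from assms(1) obtain a l where "0 < l" "Q0 = cube a l" unfolding is_cube_def by blast
  with assms(2) obtain j k where "Q = dyadic_cube a l j k" by (auto simp: dyadic_subcubes_cube)
  moreover have "0 < l / 2 ^ j" using \<open>0 < l\<close> by simp
  ultimately show ?thesis unfolding is_cube_def dyadic_cube_def by blast
qed

lemma cube_in_dyadic_subcubes:
  assumes "is_cube Q0"
  shows "Q0 \<in> dyadic_subcubes Q0"
proof -
  from assms obtain a l where al: "0 < l" "Q0 = cube a l" unfolding is_cube_def by blast
  then have "Q0 = dyadic_cube a l 0 (\<lambda>i. 0)" by (simp add: dyadic_cube_def)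
  moreover have "dyadic_cube a l 0 (\<lambda>i. 0) \<in> dyadic_subcubes (cube a l)"
    unfolding dyadic_subcubes_cube[OF al(1)] by (intro CollectI exI[of _ 0] exI[of _ "\<lambda>i. 0"]) simp
  ultimately show ?thesis using al(2) by simp
qed

lemma dyadic_subcube_subset:
  fixes Q0 :: "(real ^ 'n) set"
  assumes "is_cube Q0" "Q \<in> dyadic_subcubes Q0"
  shows "Q \<subseteq> Q0"
proof -
  from assms(1) obtain a l where al: "0 < l" "Q0 = cube a l" unfolding is_cube_def by blast
  with assms(2) obtain j k where jk: "\<forall>i. k i < 2 ^ j" "Q = dyadic_cube a l j k"
    by (auto simp: dyadic_subcubes_cube)
  define s where "s = l / 2 ^ j"
  have s: "0 < s" "l = 2 ^ j * s" using al by (auto simp: s_def)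
  have "real (k i) * s + s \<le> l" for i
  proof -
    \<comment> \<open>A strict bound on the index leaves room for one more step of length
      \<open>s\<close>, so the far face stays inside \<open>Q0\<close>.\<close>
    have "k i + 1 \<le> 2 ^ j" using jk(1) by (simp add: Suc_leI)
    then have "real (k i + 1) \<le> real (2 ^ j)" by (rule of_nat_mono)
    then have "real (k i + 1) * s \<le> 2 ^ j * s" using s(1) by (intro mult_right_mono) auto
    then show ?thesis by (simp add: s(2) algebra_simps)
  qed
  moreover have "0 \<le> real (k i) * s" for i using s by simp
  ultimately show ?thesis
    unfolding al jk(2) dyadic_cube_def s_def[symmetric]
    by (auto simp: mem_cube) (smt (verit))+
qed

text \<open>In units of the finer side all faces sit at integer offsets from the common corner. A
  shared interior point gives strict inequalities between these integers, which improve by one to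
  the inclusion.\<close>

lemma dyadic_subcubes_nested:
  fixes Q0 :: "(real ^ 'n) set"
  assumes "is_cube Q0" "Q \<in> dyadic_subcubes Q0" "R \<in> dyadic_subcubes Q0"
    and meet: "interior Q \<inter> interior R \<noteq> {}"
  shows "Q \<subseteq> R \<or> R \<subseteq> Q"
proof -
  from assms(1) obtain a l where al: "0 < l" "Q0 = cube a l" unfolding is_cube_def by blast
  have *: "dyadic_cube a l j' k' \<subseteq> dyadic_cube a l j k"
    if "j \<le> j'" and x: "x \<in> interior (dyadic_cube a l j k)" "x \<in> interior (dyadic_cube a l j' k')"
    for j j' k k' x
  proof -
    define m :: nat where "m = 2 ^ (j' - j)"
    define s where "s = l / 2 ^ j'"
    have "0 < s" using al by (simp add: s_def)
    have "(2::real) ^ j' = 2 ^ (j' - j) * 2 ^ j" using \<open>j \<le> j'\<close> by (simp flip: power_add)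
    then have s: "l / 2 ^ j = m * s" by (simp add: s_def m_def)
    have "real (k i) * (m * s) \<le> real (k' i) * s \<and> real (k' i) * s + s \<le> real (k i) * (m * s) + m * s" for i
    proof -
      have 1: "a $ i + real (k i) * (m * s) < x $ i" "x $ i < a $ i + real (k i) * (m * s) + m * s"
        "a $ i + real (k' i) * s < x $ i" "x $ i < a $ i + real (k' i) * s + s"
        using x unfolding dyadic_cube_def mem_interior_cube s s_def[symmetric] by auto
      \<comment> \<open>Compare the near face of the coarser cube with the far face of the finer
        one: below \<open>k' i + 1\<close> means at most \<open>k' i\<close>. The opposite faces are
        treated alike below.\<close>
      have "real (k i * m) * s < real (k' i + 1) * s"
        using 1(1,4) by (simp add: algebra_simps)
      then have "real (k i * m) < real (k' i + 1)" using \<open>0 < s\<close> by (simp only: mult_less_cancel_right_pos)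
      then have "k i * m \<le> k' i" unfolding of_nat_less_iff by simp
      then have "real (k i * m) * s \<le> real (k' i) * s" using \<open>0 < s\<close> by (intro mult_right_mono of_nat_mono) auto
      moreover
      have "real (k' i) * s < real ((k i + 1) * m) * s"
        using 1(2,3) by (simp add: algebra_simps)
      then have "real (k' i) < real ((k i + 1) * m)" using \<open>0 < s\<close> by (simp only: mult_less_cancel_right_pos)
      then have "k' i + 1 \<le> (k i + 1) * m" unfolding of_nat_less_iff by simp
      then have "real (k' i + 1) * s \<le> real ((k i + 1) * m) * s"
        using \<open>0 < s\<close> by (intro mult_right_mono of_nat_mono) auto
      ultimately show ?thesis by (simp add: algebra_simps)
    qed
    then show ?thesis
      unfolding dyadic_cube_def s s_def[symmetric]
      by (auto simp: mem_cube) (smt (verit))+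
  qed
  from assms(2,3) al obtain j k j' k' where Q: "Q = dyadic_cube a l j k" and R: "R = dyadic_cube a l j' k'"
    by (auto simp: dyadic_subcubes_cube)
  from meet obtain x where "x \<in> interior Q" "x \<in> interior R" by blast
  with *[of j j' x k k'] *[of j' j x k' k] show ?thesis unfolding Q R by (meson nat_le_linear)
qed

lemma cube_lmeasurable: "is_cube Q \<Longrightarrow> Q \<in> lmeasurable"
  by (auto simp: is_cube_def cube_def)

lemma measure_cube_pos:
  fixes Q :: "(real ^ 'n) set"
  assumes "is_cube Q"
  shows "0 < measure lebesgue Q"
proof -
  from assms obtain a l where al: "0 < l" "Q = cube a l" unfolding is_cube_def by blast
  then have "box a (\<chi> i. a $ i + l) \<noteq> {}" by (simp add: interval_ne_empty_cart)
  then show ?thesis unfolding al(2) cube_def using content_pos_lt_eq by (auto simp: content_pos_lt_eq box_ne_empty)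
qed

lemma negligible_cube_diff_interior: "is_cube Q \<Longrightarrow> negligible (Q - interior Q)"
  by (auto simp: is_cube_def cube_def negligible_frontier_interval)

section \<open>Dyadic cubes without boundaries\<close>

text \<open>Removing all boundaries turns the dyadic subcubes into a family that is nested as sets, without
  changing any average.\<close>

definition dyadic_boundary :: "(real ^ 'n) set \<Rightarrow> (real ^ 'n) set" where
  "dyadic_boundary Q0 = (\<Union>Q\<in>dyadic_subcubes Q0. Q - interior Q)"

definition trimmed_dyadic :: "(real ^ 'n) set \<Rightarrow> (real ^ 'n) set set" where
  "trimmed_dyadic Q0 = (\<lambda>Q. Q - dyadic_boundary Q0) ` dyadic_subcubes Q0"

lemma dyadic_boundary_null:
  assumes "is_cube Q0"
  shows "dyadic_boundary Q0 \<in> null_sets lebesgue"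
  unfolding dyadic_boundary_def negligible_iff_null_sets[symmetric]
proof (rule negligible_countable_Union)
  show "countable ((\<lambda>Q. Q - interior Q) ` dyadic_subcubes Q0)"
    using countable_dyadic_subcubes[OF assms] by simp
  show "negligible X" if "X \<in> (\<lambda>Q. Q - interior Q) ` dyadic_subcubes Q0" for X
    using that is_cube_dyadic_subcube[OF assms] negligible_cube_diff_interior by blast
qed

lemma dyadic_subcube_sets:
  "is_cube Q0 \<Longrightarrow> Q \<in> dyadic_subcubes Q0 \<Longrightarrow> Q \<in> sets lebesgue"
  using is_cube_dyadic_subcube cube_lmeasurable fmeasurableD by blast

lemma trim_sets:
  assumes "is_cube Q0" "Q \<in> dyadic_subcubes Q0"
  shows "Q - dyadic_boundary Q0 \<in> sets (lebesgue_on Q0)"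
  using assms dyadic_subcube_sets[OF assms] dyadic_subcube_sets[OF assms(1) cube_in_dyadic_subcubes[OF assms(1)]]
    dyadic_subcube_subset[OF assms] dyadic_boundary_null[OF assms(1)]
  by (subst sets_restrict_space_iff) (auto intro: sets.Diff)

lemma measure_trim:
  assumes "is_cube Q0" "Q \<in> dyadic_subcubes Q0"
  shows "measure (lebesgue_on Q0) (Q - dyadic_boundary Q0) = measure lebesgue Q"
proof -
  have "measure (lebesgue_on Q0) (Q - dyadic_boundary Q0) = measure lebesgue (Q - dyadic_boundary Q0)"
    using dyadic_subcube_subset[OF assms] dyadic_subcube_sets[OF assms(1) cube_in_dyadic_subcubes[OF assms(1)]]
    by (intro measure_restrict_space) auto
  also have "\<dots> = measure lebesgue Q"
    using dyadic_boundary_null[OF assms(1)] dyadic_subcube_sets[OF assms] by (simp add: measure_Diff_null_set)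
  finally show ?thesis .
qed

lemma AE_not_dyadic_boundary:
  assumes "is_cube Q0"
  shows "AE x in lebesgue_on Q0. x \<notin> dyadic_boundary Q0"
proof -
  have "AE x in lebesgue. x \<notin> dyadic_boundary Q0"
    by (rule AE_not_in[OF dyadic_boundary_null[OF assms]])
  then show ?thesis
    using dyadic_subcube_sets[OF assms cube_in_dyadic_subcubes[OF assms]]
    by (subst AE_restrict_space_iff) auto
qed

text \<open>Integration over \<open>lebesgue_on Q\<close> is integration against an indicator over
  \<open>Q0\<close>, and trimming alters that indicator only on a null set.\<close>

lemma mean_trim:
  assumes Q0: "is_cube Q0" and Q: "Q \<in> dyadic_subcubes Q0"
    and g: "g \<in> borel_measurable (lebesgue_on Q0)"
  shows "mean (lebesgue_on Q0) (Q - dyadic_boundary Q0) g = avg Q g"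
proof -
  have Qs: "Q \<in> sets (lebesgue_on Q0)"
    using dyadic_subcube_sets[OF Q0 Q] dyadic_subcube_subset[OF Q0 Q]
      dyadic_subcube_sets[OF Q0 cube_in_dyadic_subcubes[OF Q0]]
    by (subst sets_restrict_space_iff) auto
  have "lebesgue_on Q = restrict_space (lebesgue_on Q0) Q"
    using dyadic_subcube_subset[OF Q0 Q] dyadic_subcube_sets[OF Q0 Q]
      dyadic_subcube_sets[OF Q0 cube_in_dyadic_subcubes[OF Q0]]
    by (simp add: restrict_restrict_space Int_absorb1)
  moreover have "Q \<inter> space (lebesgue_on Q0) \<in> sets (lebesgue_on Q0)" using Qs by (simp only: sets.Int_space_eq2)
  ultimately have "(\<integral>x. g x \<partial>lebesgue_on Q) = (LINT x:Q|lebesgue_on Q0. g x)"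
    unfolding set_lebesgue_integral_def by (simp only: integral_restrict_space)
  also have "\<dots> = (LINT x:(Q - dyadic_boundary Q0)|lebesgue_on Q0. g x)"
    unfolding set_lebesgue_integral_def
  proof (rule integral_cong_AE)
    show "(\<lambda>x. indicator Q x *\<^sub>R g x) \<in> borel_measurable (lebesgue_on Q0)"
      using g Qs by measurable
    show "(\<lambda>x. indicator (Q - dyadic_boundary Q0) x *\<^sub>R g x) \<in> borel_measurable (lebesgue_on Q0)"
      using g trim_sets[OF Q0 Q] by measurable
    show "AE x in lebesgue_on Q0. indicator Q x *\<^sub>R g x = indicator (Q - dyadic_boundary Q0) x *\<^sub>R g x"
      using AE_not_dyadic_boundary[OF Q0] by eventually_elim (simp add: indicator_def)
  qed
  finally show ?thesis unfolding mean_def avg_def measure_trim[OF Q0 Q] by simp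
qed

lemma oscillation_trim:
  assumes Q0: "is_cube Q0" and Q: "Q \<in> dyadic_subcubes Q0"
    and g: "g \<in> borel_measurable (lebesgue_on Q0)"
  shows "oscillation (lebesgue_on Q0) (Q - dyadic_boundary Q0) g = avg Q (\<lambda>x. \<bar>g x - avg Q g\<bar>)"
  unfolding oscillation_def mean_trim[OF assms] by (intro mean_trim[OF Q0 Q]) (use g in measurable)

text \<open>If interiors meet, the cubes are nested, and the smaller trimmed cube has positive
  measure, hence lies nonempty in both. Conversely, a point of a dyadic cube off all boundaries is
  in its interior.\<close>

lemma trim_disjoint_iff:
  assumes Q0: "is_cube Q0" and "Q \<in> dyadic_subcubes Q0" "R \<in> dyadic_subcubes Q0"
  shows "(Q - dyadic_boundary Q0) \<inter> (R - dyadic_boundary Q0) = {} \<longleftrightarrow> interior Q \<inter> interior R = {}"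
proof
  assume *: "(Q - dyadic_boundary Q0) \<inter> (R - dyadic_boundary Q0) = {}"
  show "interior Q \<inter> interior R = {}"
  proof (rule ccontr)
    assume "interior Q \<inter> interior R \<noteq> {}"
    then have "Q \<subseteq> R \<or> R \<subseteq> Q" by (rule dyadic_subcubes_nested[OF assms])
    moreover have "S - dyadic_boundary Q0 \<noteq> {}" if "S \<in> dyadic_subcubes Q0" for S
      using measure_trim[OF Q0 that] measure_cube_pos[OF is_cube_dyadic_subcube[OF Q0 that]] by force
    ultimately show False using * assms by blast
  qed
next
  assume "interior Q \<inter> interior R = {}"
  then show "(Q - dyadic_boundary Q0) \<inter> (R - dyadic_boundary Q0) = {}"
    using assms unfolding dyadic_boundary_def by blast
qed

text \<open>Closed dyadic cubes that share only a face are neither disjoint nor nested; trimming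
  makes them disjoint.\<close>

lemma nested_family_trimmed_dyadic:
  assumes "is_cube Q0"
  shows "nested_family (lebesgue_on Q0) (trimmed_dyadic Q0)"
proof (intro nested_family.intro finite_measureI nested_family_axioms.intro)
  have "emeasure lebesgue Q0 < \<infinity>"
    using fmeasurableD2[OF cube_lmeasurable[OF assms]] by (simp add: less_top del: emeasure_completion)
  then show "emeasure (lebesgue_on Q0) (space (lebesgue_on Q0)) \<noteq> \<infinity>"
    using dyadic_subcube_sets[OF assms cube_in_dyadic_subcubes[OF assms]]
    by (simp add: emeasure_restrict_space space_restrict_space del: emeasure_completion)
  show "countable (trimmed_dyadic Q0)"
    unfolding trimmed_dyadic_def using countable_dyadic_subcubes[OF assms] by simp
  fix A assume "A \<in> trimmed_dyadic Q0"
  then obtain Q where Q: "Q \<in> dyadic_subcubes Q0" "A = Q - dyadic_boundary Q0"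
    by (auto simp: trimmed_dyadic_def)
  show "A \<in> sets (lebesgue_on Q0)" using trim_sets[OF assms Q(1)] Q(2) by simp
  show "0 < measure (lebesgue_on Q0) A"
    using measure_trim[OF assms Q(1)] Q(2) measure_cube_pos[OF is_cube_dyadic_subcube[OF assms Q(1)]] by simp
  fix B assume "B \<in> trimmed_dyadic Q0"
  then obtain R where R: "R \<in> dyadic_subcubes Q0" "B = R - dyadic_boundary Q0"
    by (auto simp: trimmed_dyadic_def)
  show "A \<inter> B = {} \<or> A \<subseteq> B \<or> B \<subseteq> A"
    using trim_disjoint_iff[OF assms Q(1) R(1)] dyadic_subcubes_nested[OF assms Q(1) R(1)]
    unfolding Q(2) R(2) by blast
qed

section \<open>Transfer of the norm to trimmed cubes\<close>

lemma JNd_sup_ge_packing: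
  fixes Q0 :: "(real ^ 'n) set"
  assumes Q0: "is_cube Q0" and g: "g \<in> borel_measurable (lebesgue_on Q0)"
    and C: "C \<in> nested_family.packings (trimmed_dyadic Q0) (space (lebesgue_on Q0))"
  shows "ennreal (\<Sum>A\<in>C. measure (lebesgue_on Q0) A * oscillation (lebesgue_on Q0) A g powr p)
    \<le> JNd_sup p Q0 g"
proof -
  interpret nested_family "lebesgue_on Q0" "trimmed_dyadic Q0"
    by (rule nested_family_trimmed_dyadic[OF Q0])
  define trim where "trim Q = Q - dyadic_boundary Q0" for Q :: "(real ^ 'n) set"
  \<comment> \<open>One dyadic cube is chosen for each trimmed set; \<open>trim\<close> inverts the
    choice, so distinct sets receive distinct cubes.\<close>
  define untrim where "untrim = inv_into (dyadic_subcubes Q0) trim"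
  have C': "finite C" "C \<subseteq> trim ` dyadic_subcubes Q0" "disjoint C"
    using C[unfolded packings_def] by (auto simp: trimmed_dyadic_def trim_def)
  have u: "untrim A \<in> dyadic_subcubes Q0" "trim (untrim A) = A" if "A \<in> C" for A
  proof -
    have A: "A \<in> trim ` dyadic_subcubes Q0" using that C'(2) by blast
    show "untrim A \<in> dyadic_subcubes Q0" unfolding untrim_def by (rule inv_into_into[OF A])
    show "trim (untrim A) = A" unfolding untrim_def by (rule f_inv_into_f[OF A])
  qed
  have inj: "inj_on untrim C" by (rule inj_on_inverseI[of _ trim]) (rule u(2))
  have "untrim ` C \<in> dyadic_collections Q0"
    unfolding dyadic_collections_def
  proof (intro CollectI conjI)
    show "pairwise (\<lambda>Q R. interior Q \<inter> interior R = {}) (untrim ` C)"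
    proof (intro pairwiseI, elim imageE)
      fix Q R A B assume *: "Q \<noteq> R" "Q = untrim A" "A \<in> C" "R = untrim B" "B \<in> C"
      then have "A \<noteq> B" by blast
      with * C'(3) have "A \<inter> B = {}" by (simp add: pairwise_def disjnt_def)
      then show "interior Q \<inter> interior R = {}"
        using trim_disjoint_iff[OF Q0 u(1)[OF *(3)] u(1)[OF *(5)]] u(2) * by (simp add: trim_def)
    qed
  qed (use u C'(1) in \<open>auto intro: countable_finite\<close>)
  then have "(\<Sum>\<^sub>\<infinity>Q\<in>untrim ` C. ennreal (measure lebesgue Q * avg Q (\<lambda>x. \<bar>g x - avg Q g\<bar>) powr p))
      \<le> JNd_sup p Q0 g"
    unfolding JNd_sup_def by (rule SUP_upper)
  also have "(\<Sum>\<^sub>\<infinity>Q\<in>untrim ` C. ennreal (measure lebesgue Q * avg Q (\<lambda>x. \<bar>g x - avg Q g\<bar>) powr p))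
      = (\<Sum>A\<in>C. ennreal (measure lebesgue (untrim A)
          * avg (untrim A) (\<lambda>x. \<bar>g x - avg (untrim A) g\<bar>) powr p))"
    using C'(1) by (simp add: sum.reindex[OF inj])
  also have "\<dots> = (\<Sum>A\<in>C. ennreal (measure (lebesgue_on Q0) A * oscillation (lebesgue_on Q0) A g powr p))"
  proof (rule sum.cong)
    fix A assume "A \<in> C"
    show "ennreal (measure lebesgue (untrim A) * avg (untrim A) (\<lambda>x. \<bar>g x - avg (untrim A) g\<bar>) powr p)
        = ennreal (measure (lebesgue_on Q0) A * oscillation (lebesgue_on Q0) A g powr p)"
      using measure_trim[OF Q0 u(1)[OF \<open>A \<in> C\<close>]] oscillation_trim[OF Q0 u(1)[OF \<open>A \<in> C\<close>] g]
        u(2)[OF \<open>A \<in> C\<close>] by (simp add: trim_def)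
  qed simp
  also have "\<dots> = ennreal (\<Sum>A\<in>C. measure (lebesgue_on Q0) A * oscillation (lebesgue_on Q0) A g powr p)"
    by (rule sum_ennreal) simp
  finally show ?thesis .
qed

text \<open>The converse comparison. An infinite sum in \<open>ennreal\<close> is the supremum of
  its finite partial sums, and each finite subcollection trims to a packing.\<close>

lemma JNd_sup_leI:
  fixes Q0 :: "(real ^ 'n) set"
  assumes Q0: "is_cube Q0" and g: "g \<in> borel_measurable (lebesgue_on Q0)"
    and le: "\<And>C. C \<in> nested_family.packings (trimmed_dyadic Q0) (space (lebesgue_on Q0)) \<Longrightarrow>
      ennreal (\<Sum>A\<in>C. measure (lebesgue_on Q0) A * oscillation (lebesgue_on Q0) A g powr p) \<le> K"
  shows "JNd_sup p Q0 g \<le> K"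
  unfolding JNd_sup_def
proof (rule SUP_least)
  interpret nested_family "lebesgue_on Q0" "trimmed_dyadic Q0"
    by (rule nested_family_trimmed_dyadic[OF Q0])
  define trim where "trim Q = Q - dyadic_boundary Q0" for Q :: "(real ^ 'n) set"
  fix C assume C: "C \<in> dyadic_collections Q0"
  have "sum (\<lambda>Q. ennreal (measure lebesgue Q * avg Q (\<lambda>x. \<bar>g x - avg Q g\<bar>) powr p)) F \<le> K"
    if F: "finite F" "F \<subseteq> C" for F
  proof -
    have FD: "F \<subseteq> dyadic_subcubes Q0" using F C by (auto simp: dyadic_collections_def)
    have disj: "trim Q \<inter> trim R = {}" if "Q \<in> F" "R \<in> F" "Q \<noteq> R" for Q R
    proof -
      have "interior Q \<inter> interior R = {}"
        using that F C unfolding dyadic_collections_def pairwise_def by blast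
      then show ?thesis using trim_disjoint_iff[OF Q0] that FD unfolding trim_def by blast
    qed
    have D: "trim Q \<in> trimmed_dyadic Q0" if "Q \<in> F" for Q
      using that FD by (auto simp: trim_def trimmed_dyadic_def)
    \<comment> \<open>Distinct cubes have disjoint, nonempty trimmed versions, so trimming merges no
      terms.\<close>
    have inj: "inj_on trim F"
    proof (rule inj_onI, rule ccontr)
      fix Q R assume "Q \<in> F" "R \<in> F" "trim Q = trim R" "Q \<noteq> R"
      with disj[of Q R] nonempty[OF D] show False by auto
    qed
    have "trim ` F \<in> packings (space (lebesgue_on Q0))"
      unfolding packings_def
    proof (intro CollectI conjI)
      show "disjoint (trim ` F)"
        using disj by (force simp: pairwise_def disjnt_def)
      show "\<forall>A\<in>trim ` F. A \<subseteq> space (lebesgue_on Q0)"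
        using D sets sets.sets_into_space by blast
    qed (use F D in auto)
    from le[OF this] have "ennreal (\<Sum>Q\<in>F. measure (lebesgue_on Q0) (trim Q)
        * oscillation (lebesgue_on Q0) (trim Q) g powr p) \<le> K"
      by (simp add: sum.reindex[OF inj])
    also have "(\<Sum>Q\<in>F. measure (lebesgue_on Q0) (trim Q) * oscillation (lebesgue_on Q0) (trim Q) g powr p)
        = (\<Sum>Q\<in>F. measure lebesgue Q * avg Q (\<lambda>x. \<bar>g x - avg Q g\<bar>) powr p)"
    proof (rule sum.cong)
      fix Q assume "Q \<in> F"
      with FD have "Q \<in> dyadic_subcubes Q0" by blast
      then show "measure (lebesgue_on Q0) (trim Q) * oscillation (lebesgue_on Q0) (trim Q) g powr p
          = measure lebesgue Q * avg Q (\<lambda>x. \<bar>g x - avg Q g\<bar>) powr p"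
        unfolding trim_def using measure_trim[OF Q0] oscillation_trim[OF Q0 _ g] by simp
    qed simp
    finally show ?thesis by (subst sum_ennreal) auto
  qed
  then show "(\<Sum>\<^sub>\<infinity>Q\<in>C. ennreal (measure lebesgue Q * avg Q (\<lambda>x. \<bar>g x - avg Q g\<bar>) powr p)) \<le> K"
    by (subst nonneg_infsum_complete) (auto intro: SUP_least)
qed

text \<open>With indicators the index set is independent of \<open>x\<close>. This form yields
  measurability as a countable supremum and matches \<open>maximal\<close>.\<close>

lemma dyadic_maximal_eq:
  "dyadic_maximal Q0 f x = (SUP Q\<in>dyadic_subcubes Q0. ennreal (avg Q (\<lambda>y. \<bar>f y\<bar>)) * indicator Q x)"
  unfolding dyadic_maximal_def
proof (rule antisym)
  show "(SUP Q\<in>{Q \<in> dyadic_subcubes Q0. x \<in> Q}. ennreal (avg Q (\<lambda>y. \<bar>f y\<bar>)))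
      \<le> (SUP Q\<in>dyadic_subcubes Q0. ennreal (avg Q (\<lambda>y. \<bar>f y\<bar>)) * indicator Q x)"
  proof (rule SUP_mono)
    fix Q assume "Q \<in> {Q \<in> dyadic_subcubes Q0. x \<in> Q}"
    then show "\<exists>R\<in>dyadic_subcubes Q0. ennreal (avg Q (\<lambda>y. \<bar>f y\<bar>)) \<le> ennreal (avg R (\<lambda>y. \<bar>f y\<bar>)) * indicator R x"
      by (intro bexI[of _ Q]) auto
  qed
  show "(SUP Q\<in>dyadic_subcubes Q0. ennreal (avg Q (\<lambda>y. \<bar>f y\<bar>)) * indicator Q x)
      \<le> (SUP Q\<in>{Q \<in> dyadic_subcubes Q0. x \<in> Q}. ennreal (avg Q (\<lambda>y. \<bar>f y\<bar>)))"
  proof (rule SUP_least)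
    fix Q assume "Q \<in> dyadic_subcubes Q0"
    then show "ennreal (avg Q (\<lambda>y. \<bar>f y\<bar>)) * indicator Q x
        \<le> (SUP Q\<in>{Q \<in> dyadic_subcubes Q0. x \<in> Q}. ennreal (avg Q (\<lambda>y. \<bar>f y\<bar>)))"
      by (cases "x \<in> Q") (auto intro: SUP_upper)
  qed
qed

lemma dyadic_maximal_measurable:
  assumes "is_cube Q0"
  shows "dyadic_maximal Q0 f \<in> borel_measurable (lebesgue_on Q0)"
proof -
  have "(\<lambda>x. ennreal (avg Q (\<lambda>y. \<bar>f y\<bar>)) * indicator Q x) \<in> borel_measurable lebesgue"
    if "Q \<in> dyadic_subcubes Q0" for Q
    using dyadic_subcube_sets[OF assms that] by measurable
  then have "(\<lambda>x. dyadic_maximal Q0 f x) \<in> borel_measurable lebesgue"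
    unfolding dyadic_maximal_eq by (intro borel_measurable_SUP countable_dyadic_subcubes assms)
  then show ?thesis by (intro measurable_restrict_space1) simp
qed

section \<open>The maximal theorem\<close>

text \<open>The constant found is \<open>2 * JN_const p\<close>, the same in every dimension.
  Finiteness almost everywhere is part of the claim because \<open>enn2real\<close> sends infinite
  values to 0; that replacement thus happens only on a null set.\<close>

theorem theorem4p2:
  fixes p :: real
  assumes "1 < p"
  shows "\<exists>c::real. 0 < c \<and>
    (\<forall>(Q0 :: (real ^ 'n) set) f. is_cube Q0 \<longrightarrow> f \<in> JNd p Q0 \<longrightarrow>
       (AE x in lebesgue_on Q0. dyadic_maximal Q0 f x < \<infinity>) \<and>
       (\<lambda>x. enn2real (dyadic_maximal Q0 f x)) \<in> JNd p Q0 \<and>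
       JNd_norm p Q0 (\<lambda>x. enn2real (dyadic_maximal Q0 f x)) \<le> c * JNd_norm p Q0 f)"
proof (intro exI[of _ "2 * JN_const p"] conjI allI impI)
  show "0 < 2 * JN_const p" using stop_ratio_ge_1[OF assms] by (simp add: JN_const_def)
  then have C: "0 \<le> 2 * JN_const p" by simp
  fix Q0 :: "(real ^ 'n) set" and f
  assume Q0: "is_cube Q0" and f: "f \<in> JNd p Q0"
  let ?M = "lebesgue_on Q0"
  let ?D = "trimmed_dyadic Q0"
  let ?h = "\<lambda>x. enn2real (dyadic_maximal Q0 f x)"
  define N where "N = dyadic_boundary Q0"
  from f have int: "integrable ?M f" and fin: "JNd_sup p Q0 f < \<infinity>" by (auto simp: JNd_def)
  have fm: "f \<in> borel_measurable ?M" using int by blast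
  obtain K where K: "0 \<le> K" "JNd_sup p Q0 f = ennreal K" using fin by (cases "JNd_sup p Q0 f") auto
  interpret nested_family ?M ?D by (rule nested_family_trimmed_dyadic[OF Q0])
  \<comment> \<open>Packing sums stay below the finite value \<open>K\<close> of the
    \<open>p\<close>-th power of the norm; this supplies \<open>bounded\<close> and the bound on
    \<open>JN (space M)\<close>.\<close>
  have le_K: "(\<Sum>A\<in>C. measure ?M A * oscillation ?M A f powr p) \<le> K" if "C \<in> packings (space ?M)" for C
    using JNd_sup_ge_packing[OF Q0 fm that, of p] K by simp
  interpret JN_function ?M ?D f p
    by unfold_locales (use int assms le_K in \<open>auto intro!: bdd_aboveI2[where M = K]\<close>)
  have "JN (space ?M) \<le> K"
    unfolding JN_def using empty_packing by (intro cSUP_least le_K) auto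
  \<comment> \<open>Up to a null set this member is the whole space, so its finiteness and
    integrability statements become global.\<close>
  have Q0_trim: "Q0 - N \<in> ?D"
    unfolding trimmed_dyadic_def N_def using cube_in_dyadic_subcubes[OF Q0] by blast
  have notin: "AE x in ?M. x \<notin> N" unfolding N_def by (rule AE_not_dyadic_boundary[OF Q0])
  have space_M: "space ?M = Q0" by (simp add: space_restrict_space)
  \<comment> \<open>Off \<open>N\<close>, a point lies in a cube exactly when it lies in the trimmed
    cube, and the averages agree by \<open>mean_trim\<close>.\<close>
  have max_eq: "dyadic_maximal Q0 f x = maximal x" if "x \<notin> N" for x
    unfolding dyadic_maximal_eq maximal_def unfolding trimmed_dyadic_def image_image
  proof (rule SUP_cong)
    fix Q assume Q: "Q \<in> dyadic_subcubes Q0"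
    have "mean ?M (Q - dyadic_boundary Q0) (\<lambda>y. \<bar>f y\<bar>) = avg Q (\<lambda>y. \<bar>f y\<bar>)"
      by (intro mean_trim[OF Q0 Q]) (use fm in measurable)
    then show "ennreal (avg Q (\<lambda>y. \<bar>f y\<bar>)) * indicator Q x
        = ennreal (mean ?M (Q - dyadic_boundary Q0) (\<lambda>y. \<bar>f y\<bar>)) * indicator (Q - dyadic_boundary Q0) x"
      using that by (simp add: N_def indicator_def)
  qed simp
  show "AE x in ?M. dyadic_maximal Q0 f x < \<infinity>"
    using AE_maximal_finite[OF Q0_trim] notin AE_space
    by eventually_elim (simp add: max_eq space_M)
  have hm: "?h \<in> borel_measurable ?M"
    using dyadic_maximal_measurable[OF Q0, of f] by measurable
  have h_int: "integrable ?M ?h"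
  proof (rule integrable_cong_AE_imp)
    show "integrable ?M (\<lambda>x. indicator (Q0 - N) x *\<^sub>R enn2real (maximal x))"
      using set_integrable_maximal[OF Q0_trim] unfolding set_integrable_def .
    show "AE x in ?M. indicator (Q0 - N) x *\<^sub>R enn2real (maximal x) = ?h x"
      using notin AE_space by eventually_elim (simp add: max_eq space_M)
  qed (rule hm)
  have sup_le: "JNd_sup p Q0 ?h \<le> ennreal ((2 * JN_const p) powr p * K)"
  proof (rule JNd_sup_leI[OF Q0 hm], rule ennreal_leI)
    fix C assume C: "C \<in> packings (space ?M)"
    have "(\<Sum>A\<in>C. measure ?M A * oscillation ?M A ?h powr p)
        = (\<Sum>A\<in>C. measure ?M A * oscillation ?M A (\<lambda>x. enn2real (maximal x)) powr p)"
    proof (rule sum.cong)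
      fix A assume "A \<in> C"
      \<comment> \<open>Members of a packing avoid \<open>N\<close>, so both maximal functions agree
        at every point of \<open>A\<close>.\<close>
      then have "A \<inter> N = {}" using C[unfolded packings_def] by (auto simp: trimmed_dyadic_def N_def)
      then have "oscillation ?M A ?h = oscillation ?M A (\<lambda>x. enn2real (maximal x))"
        by (intro oscillation_cong) (use max_eq in force)
      then show "measure ?M A * oscillation ?M A ?h powr p
          = measure ?M A * oscillation ?M A (\<lambda>x. enn2real (maximal x)) powr p" by simp
    qed simp
    also have "\<dots> \<le> (2 * JN_const p) powr p * JN (space ?M)"
      by (rule packing_oscillation_maximal[OF C])
    also have "\<dots> \<le> (2 * JN_const p) powr p * K"
      using \<open>JN (space ?M) \<le> K\<close> by (intro mult_left_mono) auto
    finally show "(\<Sum>A\<in>C. measure ?M A * oscillation ?M A ?h powr p) \<le> (2 * JN_const p) powr p * K" .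
  qed
  then show "?h \<in> JNd p Q0"
    unfolding JNd_def using h_int ennreal_less_top le_less_trans by fastforce
  have "enn2real (JNd_sup p Q0 ?h) \<le> (2 * JN_const p) powr p * K"
    using sup_le K(1) by (intro enn2real_leI) auto
  then have "JNd_norm p Q0 ?h \<le> ((2 * JN_const p) powr p * K) powr (1 / p)"
    unfolding JNd_norm_def using assms by (intro powr_mono2) auto
  also have "\<dots> = ((2 * JN_const p) powr p) powr (1 / p) * K powr (1 / p)" by (rule powr_mult)
  also have "\<dots> = 2 * JN_const p * JNd_norm p Q0 f"
    using assms C K by (simp add: powr_powr JNd_norm_def)
  finally show "JNd_norm p Q0 ?h \<le> 2 * JN_const p * JNd_norm p Q0 f" .
qed

end
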